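(* Let $X$ be a Banach space, let $\mathcal{T}=\{T(t,s)\}_{t\ge s\ge 0}$ be an evolution family on $X$, let $\rho\colon[0,\infty)\to[0,\infty)$ be a strictly increasing $C^1$ function with $\rho(0)=0$ and $\lim_{t\to\infty}\rho(t)=\infty$, and let $\{\|\cdot\|_t\}_{t\ge 0}$ be a family of norms on $X$ such that $t\mapsto\|x\|_t$ is continuous for each $x\in X$ and there exist $C>0$, $\varepsilon\ge 0$ with $\|x\|\le\|x\|_t\le Ce^{\varepsilon\rho(t)}\|x\|$ for all $x\in X$, $t\ge 0$. Assume that $\mathcal{T}$ admits a $\rho$-dichotomy with respect to the family of norms $\|\cdot\|_t$, $t\ge 0$, with projections $P(t)$, $t\ge0$, and set $Z=\operatorname{Ker}P(0)$. Then for each $y\in Y_\infty'$ there exists a unique $x\in Y_\infty^Z$ such that $$x(t)=T(t,s)x(s)+\int_s^t \rho'(\tau)T(t,\tau)y(\tau)\,d\tau\quad\text{for all } t\ge s\ge 0.$$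
   Context: $\mathcal{B}(X)$ is the algebra of bounded linear operators on the Banach space $(X,\|\cdot\|)$. A family $\{T(t,s)\}_{t\ge s\ge 0}\subset\mathcal{B}(X)$ is an evolution family if $T(t,t)=\mathrm{Id}$ for $t\ge 0$; $T(t,s)T(s,\tau)=T(t,\tau)$ for $t\ge s\ge\tau\ge 0$; and for all $s\ge 0$, $x\in X$ the map $t\mapsto T(t,s)x$ is continuous on $[s,\infty)$ and the map $t\mapsto T(s,t)x$ is continuous on $[0,s]$. Function spaces: $Y_\infty$ is the Banach space of all continuous $x\colon[0,\infty)\to X$ with $\|x\|_\infty:=\sup_{t\ge 0}\|x(t)\|_t<\infty$. For a closed subspace $Z\subset X$, $Y_\infty^Z=\{x\in Y_\infty: x(0)\in Z\}$. $Y_\infty'$ is the Banach space of all Bochner measurable $x\colon[0,\infty)\to X$ (up to a.e. equality) with $\|x\|_\infty':=\operatorname{ess\,sup}_{t\ge 0}\|x(t)\|_t<\infty$ (Lebesgue measure). $\rho$-dichotomy: $\mathcal{T}$ admits a $\rho$-dichotomy with respect to the norms $\|\cdot\|_t$ if there is a family $\{P(t)\}_{t\ge 0}$ of projections on $X$ with $T(t,s)P(s)=P(t)T(t,s)$ for $t\ge s\ge 0$, such that $T(t,s)|_{\operatorname{Ker}P(s)}\colon\operatorname{Ker}P(s)\to\operatorname{Ker}P(t)$ is invertible for all $t\ge s\ge 0$, and there are constants $\lambda,D>0$ such that for all $x\in X$: $\|T(t,s)P(s)x\|_t\le De^{-\lambda(\rho(t)-\rho(s))}\|x\|_s$ for $t\ge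 s\ge 0$, and $\|T(t,s)(\mathrm{Id}-P(s))x\|_t\le De^{-\lambda(\rho(s)-\rho(t))}\|x\|_s$ for $0\le t\le s$, where for $0\le t\le s$ one sets $T(t,s):=(T(s,t)|_{\operatorname{Ker}P(t)})^{-1}\colon\operatorname{Ker}P(s)\to\operatorname{Ker}P(t)$. *)

theory Defs
  imports "HOL-Analysis.Analysis" "HOL-Probability.Essential_Supremum"
begin

definition evolution_family :: "(real \<Rightarrow> real \<Rightarrow> 'a::banach \<Rightarrow>\<^sub>L 'a) \<Rightarrow> bool" where
  "evolution_family T \<longleftrightarrow>
     (\<forall>t\<ge>0. T t t = id_blinfun) \<and>
     (\<forall>t s \<tau>. 0 \<le> \<tau> \<and> \<tau> \<le> s \<and> s \<le> t \<longrightarrow> T t s o\<^sub>L T s \<tau> = T t \<tau>) \<and>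
     (\<forall>s\<ge>0. \<forall>x. continuous_on {s..} (\<lambda>t. T t s x) \<and> continuous_on {0..s} (\<lambda>t. T s t x))"

definition is_norm :: "('a::real_vector \<Rightarrow> real) \<Rightarrow> bool" where
  "is_norm p \<longleftrightarrow>
     (\<forall>x. 0 \<le> p x) \<and> (\<forall>x. p x = 0 \<longleftrightarrow> x = 0) \<and>
     (\<forall>c x. p (c *\<^sub>R x) = \<bar>c\<bar> * p x) \<and> (\<forall>x y. p (x + y) \<le> p x + p y)"

definition Ker :: "('a::real_normed_vector \<Rightarrow>\<^sub>L 'b::real_normed_vector) \<Rightarrow> 'a set" where
  "Ker A = {x. A x = 0}"

text \<open>For \<open>0 \<le> t \<le> s\<close>, the inverse of \<open>T s t\<close> seen as a map from \<open>Ker (P t)\<close> onto \<open>Ker (P s)\<close>;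
  it is meaningful on \<open>Ker (P s)\<close> only.\<close>

definition backward ::
  "(real \<Rightarrow> real \<Rightarrow> 'a::banach \<Rightarrow>\<^sub>L 'a) \<Rightarrow> (real \<Rightarrow> 'a \<Rightarrow>\<^sub>L 'a) \<Rightarrow> real \<Rightarrow> real \<Rightarrow> 'a \<Rightarrow> 'a" where
  "backward T P t s = inv_into (Ker (P t)) (T s t)"

definition rho_dichotomy ::
  "(real \<Rightarrow> real) \<Rightarrow> (real \<Rightarrow> 'a \<Rightarrow> real) \<Rightarrow> (real \<Rightarrow> real \<Rightarrow> 'a::banach \<Rightarrow>\<^sub>L 'a) \<Rightarrow>
     (real \<Rightarrow> 'a \<Rightarrow>\<^sub>L 'a) \<Rightarrow> bool" where
  "rho_dichotomy \<rho> nrm T P \<longleftrightarrow>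
     (\<forall>t\<ge>0. P t o\<^sub>L P t = P t) \<and>
     (\<forall>t s. 0 \<le> s \<and> s \<le> t \<longrightarrow> T t s o\<^sub>L P s = P t o\<^sub>L T t s) \<and>
     (\<forall>t s. 0 \<le> s \<and> s \<le> t \<longrightarrow> bij_betw (T t s) (Ker (P s)) (Ker (P t))) \<and>
     (\<exists>lam>0. \<exists>D>0. \<forall>x.
        (\<forall>t s. 0 \<le> s \<and> s \<le> t \<longrightarrow>
           nrm t (T t s (P s x)) \<le> D * exp (- lam * (\<rho> t - \<rho> s)) * nrm s x) \<and>
        (\<forall>t s. 0 \<le> t \<and> t \<le> s \<longrightarrow>
           nrm t (backward T P t s (x - P s x)) \<le> D * exp (- lam * (\<rho> s - \<rho> t)) * nrm s x))"

text \<open>The library's Bochner integral requires a second-countable codomain, which would restrict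
  it to separable Banach spaces. Here measurability is replaced by strong measurability; the
  rest follows \<^const>\<open>has_bochner_integral\<close>.\<close>

definition bochner_measurable :: "'b measure \<Rightarrow> ('b \<Rightarrow> 'a::banach) \<Rightarrow> bool" where
  "bochner_measurable M f \<longleftrightarrow>
     (\<exists>s. (\<forall>i. simple_function M (s i)) \<and> (AE x in M. (\<lambda>i::nat. s i x) \<longlonglongrightarrow> f x))"

definition has_banach_integral :: "'b measure \<Rightarrow> ('b \<Rightarrow> 'a::banach) \<Rightarrow> 'a \<Rightarrow> bool" where
  "has_banach_integral M f I \<longleftrightarrow>
     bochner_measurable M f \<and>
     (\<exists>s. (\<forall>i. Bochner_Integration.simple_bochner_integrable M (s i)) \<and>
        (\<lambda>i::nat. \<integral>\<^sup>+x. ennreal (norm (f x - s i x)) \<partial>M) \<longlonglongrightarrow> 0 \<and>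
        (\<lambda>i. Bochner_Integration.simple_bochner_integral M (s i)) \<longlonglongrightarrow> I)"

definition Y_norm :: "(real \<Rightarrow> 'a::banach \<Rightarrow> real) \<Rightarrow> (real \<Rightarrow> 'a) \<Rightarrow> ennreal" where
  "Y_norm nrm x = (SUP t\<in>{0..}. ennreal (nrm t (x t)))"

text \<open>Functions on \<open>[0,\<infinity>)\<close> are represented extensionally, so that equality in \<open>Y_inf\<close> is equality
  on \<open>[0,\<infinity>)\<close>.\<close>

definition Y_inf :: "(real \<Rightarrow> 'a::banach \<Rightarrow> real) \<Rightarrow> (real \<Rightarrow> 'a) set" where
  "Y_inf nrm = {x \<in> extensional {0..}. continuous_on {0..} x \<and> Y_norm nrm x < \<infinity>}"

definition Y_inf_sub :: "(real \<Rightarrow> 'a::banach \<Rightarrow> real) \<Rightarrow> 'a set \<Rightarrow> (real \<Rightarrow> 'a) set" where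
  "Y_inf_sub nrm Z = {x \<in> Y_inf nrm. x 0 \<in> Z}"

definition Y'_norm :: "(real \<Rightarrow> 'a::banach \<Rightarrow> real) \<Rightarrow> (real \<Rightarrow> 'a) \<Rightarrow> ennreal" where
  "Y'_norm nrm y = esssup (lebesgue_on {0..}) (\<lambda>t. ennreal (nrm t (y t)))"

text \<open>The elements are representatives of the a.e.-equality classes; values outside \<open>[0,\<infinity>)\<close>
  are irrelevant.\<close>

definition Y'_inf :: "(real \<Rightarrow> 'a::banach \<Rightarrow> real) \<Rightarrow> (real \<Rightarrow> 'a) set" where
  "Y'_inf nrm = {y. bochner_measurable (lebesgue_on {0..}) y \<and> Y'_norm nrm y < \<infinity>}"

end

theory Submission
  imports Defs
begin

text \<open>
  Write \<open>J s t\<close> for the integral of \<open>\<rho>' \<tau> *\<^sub>R T t \<tau> (y \<tau>)\<close> over \<open>[s, t]\<close> and \<open>B t n\<close> for the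
  complementary projection \<open>I - P n\<close> followed by the inverse of \<open>T n t\<close> on the kernels. The cocycle
  identity \<open>J r t = T t s (J r s) + J s t\<close> makes \<open>x t = P t (J 0 t) - lim B t n (J t n)\<close>
  (as \<open>n \<rightarrow> \<infinity>\<close>) a solution; this is the usual Green function formula, but with a limit in place
  of the improper integral over \<open>[t, \<infinity>)\<close>. The dichotomy estimates integrate, against \<open>\<rho>'\<close>, to bounds
  \<open>D * K / lam\<close> independent of \<open>t\<close>. The difference of two bounded solutions starting in \<open>Ker (P 0)\<close>
  is \<open>T t 0 z\<close> with \<open>z\<close> in \<open>Ker (P 0)\<close>, and the backward estimate forces \<open>z = 0\<close>.
\<close>

section \<open>Bochner integration without second countability\<close>

text \<open>\<open>T\<close> is strongly continuous in each variable separately and comes with no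
  exponential growth bound. Measurability and integrability of
  \<open>\<rho>' \<tau> *\<^sub>R T t \<tau> (y \<tau>)\<close> therefore both rest on uniform
  boundedness, and the bound over all \<open>s \<le> t \<le> t0\<close>, which continuity of
  solutions requires, also draws on the dichotomy. The limit avoids an integral of
  \<open>B t \<tau> (y \<tau>)\<close>: \<open>B\<close> is made of inverses, and its measurability
  in \<open>\<tau>\<close> would have to be proved separately. Only \<open>integrand t\<close> is
  integrated, over compact intervals; \<open>B t n\<close> acts on the finished vector
  \<open>J t n\<close>, and the dichotomy enters through seminorms such as
  \<open>nrm n (B n m v)\<close>, estimated under the integral sign. In these estimates the factor
  \<open>C * exp (\<epsilon> * \<rho> t)\<close> only makes the seminorms continuous and does not
  reach the bound. The quotient by \<open>lam\<close> comes from the antiderivative of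
  \<open>\<rho>' \<tau> * exp (c * \<rho> \<tau>)\<close> with \<open>c\<close> equal to
  \<open>lam\<close> or \<open>- lam\<close>.\<close>

abbreviation simple_bochner_integrable where
  "simple_bochner_integrable \<equiv> Bochner_Integration.simple_bochner_integrable"

abbreviation simple_bochner_integral where
  "simple_bochner_integral \<equiv> Bochner_Integration.simple_bochner_integral"

lemma has_banach_integralI:
  assumes "bochner_measurable M f" "\<And>i. simple_bochner_integrable M (s i)"
    and "(\<lambda>i::nat. \<integral>\<^sup>+x. ennreal (norm (f x - s i x)) \<partial>M) \<longlonglongrightarrow> 0"
    and "(\<lambda>i. simple_bochner_integral M (s i)) \<longlonglongrightarrow> I"
  shows "has_banach_integral M f I"
  using assms unfolding has_banach_integral_def by blast

lemma has_banach_integralE: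
  assumes "has_banach_integral M f I"
  obtains s where "bochner_measurable M f" "\<And>i. simple_bochner_integrable M (s i)"
    "(\<lambda>i::nat. \<integral>\<^sup>+x. ennreal (norm (f x - s i x)) \<partial>M) \<longlonglongrightarrow> 0"
    "(\<lambda>i. simple_bochner_integral M (s i)) \<longlonglongrightarrow> I"
  using assms unfolding has_banach_integral_def by blast

section \<open>Strong measurability\<close>

text \<open>Setting the approximants to 0 on a null set makes them converge everywhere, so that
  limits of real functions built from them are measurable even if \<open>M\<close> is not
  complete.\<close>

lemma bochner_measurable_pointwise_limit:
  assumes "bochner_measurable M f"
  obtains f' s where "\<And>i. simple_function M (s i)" "\<And>x. (\<lambda>i::nat. s i x) \<longlonglongrightarrow> f' x"
    "AE x in M. f x = f' x"
proof -
  obtain s where s: "\<And>i. simple_function M (s i)"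
    and lim: "AE x in M. (\<lambda>i::nat. s i x) \<longlonglongrightarrow> f x"
    using assms unfolding bochner_measurable_def by blast
  obtain N where N: "\<And>x. x \<in> space M - N \<Longrightarrow> (\<lambda>i. s i x) \<longlonglongrightarrow> f x" "N \<in> null_sets M"
    using AE_E3[OF lim] by blast
  have sets: "(space M - N) \<inter> space M \<in> sets M"
    using N(2) by auto
  show ?thesis
  proof
    show "simple_function M (\<lambda>x. if x \<in> space M - N then s i x else 0)" for i
      using simple_function_If_set[OF s simple_function_const sets] .
    show "(\<lambda>i. if x \<in> space M - N then s i x else 0) \<longlonglongrightarrow> (if x \<in> space M - N then f x else 0)" for x
      using N(1) by auto
    show "AE x in M. f x = (if x \<in> space M - N then f x else 0)"
      using AE_not_in[OF N(2)] by (auto elim: eventually_mono)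
  qed
qed

text \<open>\<open>M\<close> may be incomplete and \<open>f\<close> is determined by its
  approximants only a.e., so its norm need not be measurable itself; \<open>h\<close> is a
  measurable version of it.\<close>

lemma bochner_measurable_norm_AE:
  assumes "bochner_measurable M f"
  shows "\<exists>h\<in>borel_measurable M. AE x in M. ennreal (norm (f x)) = h x"
proof -
  obtain f' s where s: "\<And>i. simple_function M (s i)" and lim: "\<And>x. (\<lambda>i::nat. s i x) \<longlonglongrightarrow> f' x"
    and f': "AE x in M. f x = f' x"
    by (rule bochner_measurable_pointwise_limit[OF assms]) (rule that)
  have "(\<lambda>x. norm (s i x)) \<in> borel_measurable M" for i
    by (intro borel_measurable_simple_function simple_function_compose1[OF s])
  then have "(\<lambda>x. norm (f' x)) \<in> borel_measurable M"
    by (rule borel_measurable_LIMSEQ_real[OF tendsto_norm[OF lim]])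
  then show ?thesis
    using f' by (intro bexI[of _ "\<lambda>x. ennreal (norm (f' x))"]) (auto elim: eventually_mono)
qed

lemma bochner_measurable_compose2:
  assumes f: "bochner_measurable M f" and g: "bochner_measurable M g"
    and h: "\<And>a b u v. u \<longlonglongrightarrow> a \<Longrightarrow> v \<longlonglongrightarrow> b \<Longrightarrow> (\<lambda>i. h (u i) (v i)) \<longlonglongrightarrow> h a b"
  shows "bochner_measurable M (\<lambda>x. h (f x) (g x))"
proof -
  obtain s where s: "\<And>i. simple_function M (s i)" "AE x in M. (\<lambda>i::nat. s i x) \<longlonglongrightarrow> f x"
    using f unfolding bochner_measurable_def by blast
  obtain t where t: "\<And>i. simple_function M (t i)" "AE x in M. (\<lambda>i::nat. t i x) \<longlonglongrightarrow> g x"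
    using g unfolding bochner_measurable_def by blast
  show ?thesis
    unfolding bochner_measurable_def
  proof (intro exI conjI allI)
    show "simple_function M (\<lambda>x. h (s i x) (t i x))" for i
      using s(1) t(1) by (rule simple_function_compose2)
    show "AE x in M. (\<lambda>i. h (s i x) (t i x)) \<longlonglongrightarrow> h (f x) (g x)"
      using s(2) t(2) by eventually_elim (rule h)
  qed
qed

lemma bochner_measurable_simple: "simple_function M s \<Longrightarrow> bochner_measurable M s"
  unfolding bochner_measurable_def by (rule exI[of _ "\<lambda>_. s"]) auto

lemma bochner_measurable_cong_AE:
  assumes "bochner_measurable M f" "AE x in M. f x = g x"
  shows "bochner_measurable M g"
proof -
  obtain s where s: "\<And>i. simple_function M (s i)" "AE x in M. (\<lambda>i::nat. s i x) \<longlonglongrightarrow> f x"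
    using assms(1) unfolding bochner_measurable_def by blast
  from s(2) assms(2) have "AE x in M. (\<lambda>i::nat. s i x) \<longlonglongrightarrow> g x"
    by eventually_elim simp
  with s(1) show ?thesis unfolding bochner_measurable_def by blast
qed

lemma bochner_measurable_norm_diff_AE:
  assumes "bochner_measurable M f" "simple_function M s"
  shows "\<exists>h\<in>borel_measurable M. AE x in M. ennreal (norm (f x - s x)) = h x"
proof (rule bochner_measurable_norm_AE)
  show "bochner_measurable M (\<lambda>x. f x - s x)"
    using assms(1) bochner_measurable_simple[OF assms(2)] tendsto_diff
    by (rule bochner_measurable_compose2[where h="(-)"])
qed

text \<open>Additivity of the nonnegative integral asks for measurable summands, while
  \<open>b\<close> will be a norm that is measurable only up to a null set; hence it is traded for
  \<open>h\<close> and back.\<close>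

lemma nn_integral_le_add_cmult:
  assumes "a \<in> borel_measurable M" and "\<exists>h\<in>borel_measurable M. AE x in M. b x = h x"
    and le: "AE x in M. f x \<le> a x + c * b x"
  shows "(\<integral>\<^sup>+x. f x \<partial>M) \<le> (\<integral>\<^sup>+x. a x \<partial>M) + c * (\<integral>\<^sup>+x. b x \<partial>M)"
proof -
  obtain h where h [measurable]: "h \<in> borel_measurable M" and bh: "AE x in M. b x = h x"
    using assms(2) by blast
  have "(\<integral>\<^sup>+x. f x \<partial>M) \<le> (\<integral>\<^sup>+x. a x + c * h x \<partial>M)"
    using le bh by (intro nn_integral_mono_AE) (auto elim: eventually_elim2)
  also have "\<dots> = (\<integral>\<^sup>+x. a x \<partial>M) + c * (\<integral>\<^sup>+x. h x \<partial>M)"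
    using assms(1) by (simp add: nn_integral_add nn_integral_cmult)
  also have "(\<integral>\<^sup>+x. h x \<partial>M) = (\<integral>\<^sup>+x. b x \<partial>M)"
    using bh by (intro nn_integral_cong_AE) (auto elim: eventually_mono)
  finally show ?thesis .
qed

lemma tendsto_0_le_ennreal:
  fixes f g :: "nat \<Rightarrow> ennreal"
  assumes "\<And>i. f i \<le> g i" "g \<longlonglongrightarrow> 0"
  shows "f \<longlonglongrightarrow> 0"
  using tendsto_sandwich[OF _ _ tendsto_const assms(2), of f] assms(1) by simp

section \<open>Integral estimates in a continuous seminorm\<close>

text \<open>The dichotomy is integrated in \<open>nrm t (P t x)\<close> and
  \<open>nrm n (B n m x)\<close>, which vanish on whole subspaces, so the integral inequality is
  proved for seminorms. \<open>bound\<close> supplies continuity; \<open>c\<close> does not appear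
  in the resulting inequality.\<close>

locale bounded_seminorm =
  fixes p :: "'a::banach \<Rightarrow> real" and c :: real
  assumes triangle: "p (x + y) \<le> p x + p y"
    and scale: "p (r *\<^sub>R x) = \<bar>r\<bar> * p x"
    and bound: "p x \<le> c * norm x"
    and c_nonneg: "0 \<le> c"
begin

lemma zero [simp]: "p 0 = 0"
  using scale[of 0 0] by simp

lemma minus: "p (- x) = p x"
  using scale[of "-1" x] by simp

lemma nonneg: "0 \<le> p x"
  using triangle[of x "- x"] minus[of x] by simp

lemma sum_le: "p (\<Sum>i\<in>A. f i) \<le> (\<Sum>i\<in>A. p (f i))"
proof (induction A rule: infinite_finite_induct)
  case (insert i A)
  then show ?case using triangle[of "f i" "sum f A"] by simp
qed auto

lemma diff_le: "\<bar>p x - p y\<bar> \<le> c * norm (x - y)"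
  using triangle[of "x - y" y] triangle[of "y - x" x] bound[of "x - y"] bound[of "y - x"]
  by (simp add: norm_minus_commute)

lemma tendsto:
  assumes "(f \<longlongrightarrow> l) F"
  shows "((\<lambda>x. p (f x)) \<longlongrightarrow> p l) F"
proof -
  have lim: "((\<lambda>x. c * norm (f x - l)) \<longlongrightarrow> 0) F"
    using tendsto_mult_left[OF tendsto_norm[OF tendsto_diff[OF assms tendsto_const]], of c l] by simp
  have "((\<lambda>x. p (f x) - p l) \<longlongrightarrow> 0) F"
    by (rule Lim_null_comparison[OF always_eventually lim]) (simp add: diff_le)
  then show ?thesis by (simp add: LIM_zero_iff)
qed

lemma simple_bochner_integral_le:
  assumes s: "simple_bochner_integrable M s"
  shows "ennreal (p (simple_bochner_integral M s)) \<le> (\<integral>\<^sup>+x. p (s x) \<partial>M)"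
proof -
  have sf: "simple_function M s"
    using s by (auto elim: simple_bochner_integrable.cases)
  have ps: "simple_bochner_integrable M (\<lambda>x. p (s x))"
    using simple_bochner_integrable_compose2[of "\<lambda>x y. p x", OF _ s s] by simp
  have "p (simple_bochner_integral M s) \<le> (\<Sum>y\<in>s ` space M. measure M {x \<in> space M. s x = y} * p y)"
    unfolding simple_bochner_integral_def by (rule order_trans[OF sum_le]) (simp add: scale)
  \<comment> \<open>The sum runs over the level sets of \<open>s\<close>, which are finer than those
    of \<open>p (s x)\<close>.\<close>
  also have "\<dots> = simple_bochner_integral M (\<lambda>x. p (s x))"
    using simple_bochner_integral_partition[OF ps sf, of p] by simp
  finally show ?thesis
    using simple_bochner_integral_eq_nn_integral[OF ps] by (metis ennreal_leI nonneg)
qed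

text \<open>The approximants need not be dominated by \<open>g\<close>, but \<open>p (s i x)\<close>
  exceeds it by at most \<open>c * norm (f x - s i x)\<close>, whose integral tends to 0.\<close>

lemma has_banach_integral_le:
  fixes f :: "'b \<Rightarrow> 'a::banach"
  assumes I: "has_banach_integral M f I" and g: "g \<in> borel_measurable M"
    and le: "AE x in M. ennreal (p (f x)) \<le> g x"
  shows "ennreal (p I) \<le> (\<integral>\<^sup>+x. g x \<partial>M)"
proof -
  obtain s where f: "bochner_measurable M f"
    and s: "\<And>i. simple_bochner_integrable M (s i)"
    and fs: "(\<lambda>i::nat. \<integral>\<^sup>+x. ennreal (norm (f x - s i x)) \<partial>M) \<longlonglongrightarrow> 0"
    and lim: "(\<lambda>i. simple_bochner_integral M (s i)) \<longlonglongrightarrow> I"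
    using I by (rule has_banach_integralE) (rule that)
  have "ennreal (p (simple_bochner_integral M (s i)))
      \<le> (\<integral>\<^sup>+x. g x \<partial>M) + ennreal c * (\<integral>\<^sup>+x. ennreal (norm (f x - s i x)) \<partial>M)" for i
  proof -
    have "(\<integral>\<^sup>+x. p (s i x) \<partial>M) \<le> (\<integral>\<^sup>+x. g x \<partial>M) + ennreal c * (\<integral>\<^sup>+x. ennreal (norm (f x - s i x)) \<partial>M)"
    proof (rule nn_integral_le_add_cmult[OF g])
      show "\<exists>h\<in>borel_measurable M. AE x in M. ennreal (norm (f x - s i x)) = h x"
        using bochner_measurable_norm_diff_AE[OF f] s[of i] by (auto elim: simple_bochner_integrable.cases)
      show "AE x in M. ennreal (p (s i x)) \<le> g x + ennreal c * ennreal (norm (f x - s i x))"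
        using le
      proof eventually_elim
        case (elim x)
        have "p (s i x) \<le> p (f x) + c * norm (f x - s i x)"
          using diff_le[of "f x" "s i x"] by linarith
        then have "ennreal (p (s i x)) \<le> ennreal (p (f x)) + ennreal c * ennreal (norm (f x - s i x))"
          by (simp add: c_nonneg nonneg flip: ennreal_mult ennreal_plus)
        then show ?case using elim by (meson add_right_mono order_trans)
      qed
    qed
    then show ?thesis using simple_bochner_integral_le[OF s[of i]] by (rule order_trans[rotated])
  qed
  moreover have "(\<lambda>i. ennreal (p (simple_bochner_integral M (s i)))) \<longlonglongrightarrow> ennreal (p I)"
    by (intro tendsto_ennrealI tendsto lim)
  moreover have "(\<lambda>i. (\<integral>\<^sup>+x. g x \<partial>M) + ennreal c * (\<integral>\<^sup>+x. ennreal (norm (f x - s i x)) \<partial>M))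
      \<longlonglongrightarrow> (\<integral>\<^sup>+x. g x \<partial>M) + ennreal c * 0"
    by (intro tendsto_add tendsto_const ennreal_tendsto_cmult fs) auto
  ultimately show ?thesis
    by (intro LIMSEQ_le) auto
qed

end

lemma bounded_seminorm_norm: "bounded_seminorm norm 1"
  by standard (auto simp: norm_triangle_ineq)

section \<open>Linearity, uniqueness, additivity over intervals, existence\<close>

lemma has_banach_integral_cong_AE:
  assumes "has_banach_integral M f I" and fg: "AE x in M. f x = g x"
  shows "has_banach_integral M g I"
proof -
  have "(\<integral>\<^sup>+x. ennreal (norm (g x - s x)) \<partial>M) = (\<integral>\<^sup>+x. ennreal (norm (f x - s x)) \<partial>M)" for s
    using fg by (intro nn_integral_cong_AE) (auto elim: eventually_mono)
  then show ?thesis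
    using assms(1) bochner_measurable_cong_AE[OF _ fg] unfolding has_banach_integral_def by auto
qed

lemma has_banach_integral_linear:
  fixes f :: "'b \<Rightarrow> 'a::banach" and A :: "'a \<Rightarrow> 'c::banach"
  assumes I: "has_banach_integral M f I" and A: "bounded_linear A"
  shows "has_banach_integral M (\<lambda>x. A (f x)) (A I)"
proof -
  interpret A: bounded_linear A by fact
  obtain s where f: "bochner_measurable M f"
    and s: "\<And>i. simple_bochner_integrable M (s i)"
    and fs: "(\<lambda>i::nat. \<integral>\<^sup>+x. ennreal (norm (f x - s i x)) \<partial>M) \<longlonglongrightarrow> 0"
    and lim: "(\<lambda>i. simple_bochner_integral M (s i)) \<longlonglongrightarrow> I"
    using I by (rule has_banach_integralE) (rule that)
  obtain K where K: "\<And>x. norm (A x) \<le> norm x * K" "K \<ge> 0"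
    using A.nonneg_bounded by blast
  have "(\<integral>\<^sup>+x. ennreal (norm (A (f x) - A (s i x))) \<partial>M)
      \<le> ennreal K * (\<integral>\<^sup>+x. ennreal (norm (f x - s i x)) \<partial>M)" for i
  proof -
    have "\<exists>h\<in>borel_measurable M. AE x in M. ennreal (norm (f x - s i x)) = h x"
      using bochner_measurable_norm_diff_AE[OF f] s[of i] by (auto elim: simple_bochner_integrable.cases)
    moreover have "ennreal (norm (A (f x) - A (s i x))) \<le> 0 + ennreal K * ennreal (norm (f x - s i x))" for x
      using K by (simp add: mult.commute flip: A.diff ennreal_mult)
    ultimately show ?thesis
      using nn_integral_le_add_cmult[of "\<lambda>_. 0" M "\<lambda>x. ennreal (norm (f x - s i x))"] by simp
  qed
  moreover have "(\<lambda>i. ennreal K * (\<integral>\<^sup>+x. ennreal (norm (f x - s i x)) \<partial>M)) \<longlonglongrightarrow> 0"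
    using ennreal_tendsto_cmult[OF _ fs, of "ennreal K"] by simp
  ultimately have to0: "(\<lambda>i. \<integral>\<^sup>+x. ennreal (norm (A (f x) - A (s i x))) \<partial>M) \<longlonglongrightarrow> 0"
    by (rule tendsto_0_le_ennreal)
  have "bochner_measurable M (\<lambda>x. A (f x))"
    by (rule bochner_measurable_compose2[OF f f, of "\<lambda>x y. A x"]) (rule A.tendsto)
  moreover have "simple_bochner_integrable M (\<lambda>x. A (s i x))" for i
    using simple_bochner_integrable_compose2[of "\<lambda>x y. A x", OF _ s s] by (simp add: A.zero)
  moreover have "(\<lambda>i. simple_bochner_integral M (\<lambda>x. A (s i x))) \<longlonglongrightarrow> A I"
    unfolding simple_bochner_integral_linear[OF A.linear_axioms s] by (rule A.tendsto[OF lim])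
  ultimately show ?thesis
    using to0 by (intro has_banach_integralI)
qed

lemma has_banach_integral_add:
  assumes I: "has_banach_integral M f I" and J: "has_banach_integral M g J"
  shows "has_banach_integral M (\<lambda>x. f x + g x) (I + J)"
proof -
  obtain s where f: "bochner_measurable M f"
    and s: "\<And>i. simple_bochner_integrable M (s i)"
    and fs: "(\<lambda>i::nat. \<integral>\<^sup>+x. ennreal (norm (f x - s i x)) \<partial>M) \<longlonglongrightarrow> 0"
    and lim: "(\<lambda>i. simple_bochner_integral M (s i)) \<longlonglongrightarrow> I"
    using I by (rule has_banach_integralE) (rule that)
  obtain t where g: "bochner_measurable M g"
    and t: "\<And>i. simple_bochner_integrable M (t i)"
    and gt: "(\<lambda>i::nat. \<integral>\<^sup>+x. ennreal (norm (g x - t i x)) \<partial>M) \<longlonglongrightarrow> 0"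
    and lim': "(\<lambda>i. simple_bochner_integral M (t i)) \<longlonglongrightarrow> J"
    using J by (rule has_banach_integralE) (rule that)
  have "(\<integral>\<^sup>+x. ennreal (norm (f x + g x - (s i x + t i x))) \<partial>M)
      \<le> (\<integral>\<^sup>+x. ennreal (norm (f x - s i x)) \<partial>M) + 1 * (\<integral>\<^sup>+x. ennreal (norm (g x - t i x)) \<partial>M)" for i
  proof -
    obtain h where h: "h \<in> borel_measurable M" "AE x in M. ennreal (norm (f x - s i x)) = h x"
      using bochner_measurable_norm_diff_AE[OF f] s[of i] by (auto elim: simple_bochner_integrable.cases)
    have "(\<integral>\<^sup>+x. ennreal (norm (f x + g x - (s i x + t i x))) \<partial>M)
      \<le> (\<integral>\<^sup>+x. h x \<partial>M) + 1 * (\<integral>\<^sup>+x. ennreal (norm (g x - t i x)) \<partial>M)"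
    proof (rule nn_integral_le_add_cmult[OF h(1)])
      show "\<exists>h\<in>borel_measurable M. AE x in M. ennreal (norm (g x - t i x)) = h x"
        using bochner_measurable_norm_diff_AE[OF g] t[of i] by (auto elim: simple_bochner_integrable.cases)
      show "AE x in M. ennreal (norm (f x + g x - (s i x + t i x))) \<le> h x + 1 * ennreal (norm (g x - t i x))"
        using h(2)
      proof eventually_elim
        case (elim x)
        have "norm (f x + g x - (s i x + t i x)) \<le> norm (f x - s i x) + norm (g x - t i x)"
          by (simp add: add_diff_add norm_triangle_ineq)
        then show ?case
          unfolding elim[symmetric] by (simp flip: ennreal_plus)
      qed
    qed
    also have "(\<integral>\<^sup>+x. h x \<partial>M) = (\<integral>\<^sup>+x. ennreal (norm (f x - s i x)) \<partial>M)"
      using h(2) by (intro nn_integral_cong_AE) (auto elim: eventually_mono)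
    finally show ?thesis .
  qed
  moreover have "(\<lambda>i. (\<integral>\<^sup>+x. ennreal (norm (f x - s i x)) \<partial>M) + 1 * (\<integral>\<^sup>+x. ennreal (norm (g x - t i x)) \<partial>M)) \<longlonglongrightarrow> 0"
    using tendsto_add[OF fs gt] by simp
  ultimately have "(\<lambda>i. \<integral>\<^sup>+x. ennreal (norm (f x + g x - (s i x + t i x))) \<partial>M) \<longlonglongrightarrow> 0"
    by (rule tendsto_0_le_ennreal)
  moreover have "bochner_measurable M (\<lambda>x. f x + g x)"
    by (intro bochner_measurable_compose2[where h="(+)"] f g tendsto_add)
  moreover have "simple_bochner_integrable M (\<lambda>x. s i x + t i x)" for i
    by (intro simple_bochner_integrable_compose2[where p="(+)"] s t) simp
  moreover have "(\<lambda>i. simple_bochner_integral M (\<lambda>x. s i x + t i x)) \<longlonglongrightarrow> I + J"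
    unfolding simple_bochner_integral_add[OF s t] by (intro tendsto_add lim lim')
  ultimately show ?thesis
    by (intro has_banach_integralI[where s="\<lambda>i x. s i x + t i x"])
qed

text \<open>Adding \<open>- f\<close> makes \<open>I - J\<close> an integral of the zero
  function.\<close>

lemma has_banach_integral_unique:
  assumes "has_banach_integral M f I" "has_banach_integral M f J"
  shows "I = J"
proof -
  have "has_banach_integral M (\<lambda>x. f x + - f x) (I + - J)"
    by (intro has_banach_integral_add assms has_banach_integral_linear[OF _ bounded_linear_minus]
        bounded_linear_ident)
  then have "ennreal (norm (I + - J)) \<le> (\<integral>\<^sup>+x. 0 \<partial>M)"
    by (rule bounded_seminorm.has_banach_integral_le[OF bounded_seminorm_norm]) auto
  then show ?thesis by simp
qed

text \<open>Extension by zero brings integrals over different intervals into one measure, where they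
  can be added.\<close>

lemma has_banach_integral_restrict_space:
  assumes S: "S \<inter> space M \<in> sets M" and I: "has_banach_integral (restrict_space M S) f I"
  shows "has_banach_integral M (\<lambda>x. indicator S x *\<^sub>R f x) I"
proof -
  obtain s where f: "bochner_measurable (restrict_space M S) f"
    and s: "\<And>i. simple_bochner_integrable (restrict_space M S) (s i)"
    and fs: "(\<lambda>i::nat. \<integral>\<^sup>+x. ennreal (norm (f x - s i x)) \<partial>restrict_space M S) \<longlonglongrightarrow> 0"
    and lim: "(\<lambda>i. simple_bochner_integral (restrict_space M S) (s i)) \<longlonglongrightarrow> I"
    using I by (rule has_banach_integralE) (rule that)
  obtain u where u: "\<And>i. simple_function (restrict_space M S) (u i)"
      "AE x in restrict_space M S. (\<lambda>i::nat. u i x) \<longlonglongrightarrow> f x"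
    using f unfolding bochner_measurable_def by blast
  have "AE x in M. (\<lambda>i. indicator S x *\<^sub>R u i x) \<longlonglongrightarrow> indicator S x *\<^sub>R f x"
    using u(2) unfolding AE_restrict_space_iff[OF S]
    by eventually_elim (auto simp: indicator_def)
  then have "bochner_measurable M (\<lambda>x. indicator S x *\<^sub>R f x)"
    using u(1) unfolding simple_function_restrict_space[OF S] bochner_measurable_def
    by (intro exI[of _ "\<lambda>i x. indicator S x *\<^sub>R u i x"]) simp
  moreover have "(\<integral>\<^sup>+x. ennreal (norm (f x - s i x)) \<partial>restrict_space M S)
      = (\<integral>\<^sup>+x. ennreal (norm (indicator S x *\<^sub>R f x - indicator S x *\<^sub>R s i x)) \<partial>M)" for i
    unfolding nn_integral_restrict_space[OF S]
    by (intro nn_integral_cong) (auto simp: indicator_def)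
  ultimately show ?thesis
    using s fs lim unfolding simple_bochner_integrable_restrict_space[OF S]
      simple_bochner_integral_restrict_space[OF S s]
    by (intro has_banach_integralI[where s="\<lambda>i x. indicator S x *\<^sub>R s i x"]) simp_all
qed

lemma has_banach_integral_combine:
  fixes a b c :: real
  assumes "a \<le> b" "b \<le> c"
    and I: "has_banach_integral (lebesgue_on {a..b}) f I"
    and J: "has_banach_integral (lebesgue_on {b..c}) f J"
    and K: "has_banach_integral (lebesgue_on {a..c}) f K"
  shows "K = I + J"
proof -
  have "has_banach_integral lebesgue (\<lambda>x. indicator {a..b} x *\<^sub>R f x + indicator {b..c} x *\<^sub>R f x) (I + J)"
    by (intro has_banach_integral_add has_banach_integral_restrict_space I J) auto
  moreover have "AE x in lebesgue.
      indicator {a..b} x *\<^sub>R f x + indicator {b..c} x *\<^sub>R f x = indicator {a..c} x *\<^sub>R f x"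
  proof (rule AE_I')
    \<comment> \<open>The closed intervals share the point \<open>b\<close>, where the sum counts
      \<open>f b\<close> twice.\<close>
    show "{b} \<in> null_sets lebesgue"
      by (simp add: null_sets_completion_iff)
  qed (use assms(1,2) in \<open>auto simp: indicator_def split: if_splits\<close>)
  ultimately have "has_banach_integral lebesgue (\<lambda>x. indicator {a..c} x *\<^sub>R f x) (I + J)"
    by (rule has_banach_integral_cong_AE)
  moreover have "has_banach_integral lebesgue (\<lambda>x. indicator {a..c} x *\<^sub>R f x) K"
    by (intro has_banach_integral_restrict_space K) auto
  ultimately show ?thesis by (metis has_banach_integral_unique)
qed

text \<open>Truncation gives the approximants a common bound without losing convergence. On a finite
  measure space dominated convergence then yields convergence in mean, so the simple integrals form
  a Cauchy sequence.\<close>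

lemma has_banach_integral_exists:
  fixes f :: "'b \<Rightarrow> 'a::banach"
  assumes f: "bochner_measurable M f" and fin: "emeasure M (space M) < \<infinity>"
    and bnd: "AE x in M. norm (f x) \<le> B"
  shows "\<exists>I. has_banach_integral M f I"
proof -
  obtain f' s where s: "\<And>i. simple_function M (s i)" and lim: "\<And>x. (\<lambda>i::nat. s i x) \<longlonglongrightarrow> f' x"
    and f': "AE x in M. f x = f' x"
    by (rule bochner_measurable_pointwise_limit[OF f]) (rule that)
  \<comment> \<open>The margin 1 puts \<open>norm (f x)\<close> strictly below the threshold, so
    eventually \<open>s i x\<close> is not cut off. The absolute value guards against a negative
    \<open>B\<close>.\<close>
  define u where "u i x = (if norm (s i x) \<le> \<bar>B\<bar> + 1 then s i x else 0)" for i x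
  have u: "simple_function M (u i)" for i
    unfolding u_def by (rule simple_function_compose1[OF s, of "\<lambda>v. if norm v \<le> \<bar>B\<bar> + 1 then v else 0"])
  have u_bnd: "norm (u i x) \<le> \<bar>B\<bar> + 1" for i x
    by (auto simp: u_def)
  have u_sbi: "simple_bochner_integrable M (u i)" for i
  proof (rule simple_bochner_integrableI_bounded[OF u])
    have "(\<integral>\<^sup>+x. norm (u i x) \<partial>M) \<le> (\<integral>\<^sup>+x. ennreal (\<bar>B\<bar> + 1) \<partial>M)"
      by (intro nn_integral_mono ennreal_leI u_bnd)
    also have "\<dots> < \<infinity>" using fin by (auto simp: ennreal_mult_less_top)
    finally show "(\<integral>\<^sup>+x. norm (u i x) \<partial>M) < \<infinity>" .
  qed
  have ulim: "AE x in M. (\<lambda>i. u i x) \<longlonglongrightarrow> f x"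
    using f' bnd
  proof eventually_elim
    case (elim x)
    have "eventually (\<lambda>i. norm (s i x) < \<bar>B\<bar> + 1) sequentially"
      using elim by (intro order_tendstoD(2)[OF tendsto_norm[OF lim[of x]]]) auto
    then have "eventually (\<lambda>i. s i x = u i x) sequentially"
      by eventually_elim (simp add: u_def)
    then show ?case
      using lim[of x] elim(1) by (simp add: tendsto_cong)
  qed
  define e where "e i = (\<integral>\<^sup>+x. ennreal (norm (f x - u i x)) \<partial>M)" for i
  have meas: "\<exists>h\<in>borel_measurable M. AE x in M. ennreal (norm (f x - u i x)) = h x" for i
    by (rule bochner_measurable_norm_diff_AE[OF f u])
  have e: "e \<longlonglongrightarrow> 0"
  proof -
    obtain h where h: "\<And>i. h i \<in> borel_measurable M"
        "\<And>i. AE x in M. ennreal (norm (f x - u i x)) = h i x"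
      using meas by metis
    \<comment> \<open>Countably many null sets are merged: convergence of \<open>h i x\<close> at a
      point involves all \<open>i\<close> at once.\<close>
    have h': "AE x in M. \<forall>i. ennreal (norm (f x - u i x)) = h i x"
      using h(2) by (simp add: AE_all_countable)
    have "(\<lambda>i. \<integral>\<^sup>+x. h i x \<partial>M) \<longlonglongrightarrow> (\<integral>\<^sup>+x. 0 \<partial>M)"
    proof (rule nn_integral_dominated_convergence)
      show "AE x in M. h i x \<le> ennreal (2 * \<bar>B\<bar> + 1)" for i
        using h(2)[of i] bnd
      proof eventually_elim
        case (elim x)
        have "norm (f x - u i x) \<le> 2 * \<bar>B\<bar> + 1"
          using elim(2) u_bnd[of i x] norm_triangle_ineq4[of "f x" "u i x"] by linarith
        then show ?case using elim(1) by (metis ennreal_leI)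
      qed
      show "(\<integral>\<^sup>+x. ennreal (2 * \<bar>B\<bar> + 1) \<partial>M) < \<infinity>"
        using fin by (auto simp: ennreal_mult_less_top)
      show "AE x in M. (\<lambda>i. h i x) \<longlonglongrightarrow> 0"
        using h' ulim
      proof eventually_elim
        case (elim x)
        have "(\<lambda>i. ennreal (norm (f x - u i x))) \<longlonglongrightarrow> ennreal (norm (f x - f x))"
          by (intro tendsto_ennrealI tendsto_norm tendsto_diff tendsto_const elim)
        then show ?case using elim(1) by simp
      qed
    qed (use h in auto)
    moreover have "e = (\<lambda>i. \<integral>\<^sup>+x. h i x \<partial>M)"
      unfolding e_def by (intro ext nn_integral_cong_AE[OF h(2)])
    ultimately show ?thesis by simp
  qed
  have diff: "ennreal (norm (simple_bochner_integral M (u i) - simple_bochner_integral M (u j))) \<le> e i + e j" for i j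
  proof -
    obtain h where h: "h \<in> borel_measurable M" "AE x in M. ennreal (norm (f x - u i x)) = h x"
      using meas[of i] by blast
    have sb: "simple_bochner_integrable M (\<lambda>x. u i x - u j x)"
      by (intro simple_bochner_integrable_compose2[where p="(-)"] u_sbi) simp
    have "ennreal (norm (simple_bochner_integral M (u i) - simple_bochner_integral M (u j)))
        \<le> (\<integral>\<^sup>+x. norm (u i x - u j x) \<partial>M)"
      using bounded_seminorm.simple_bochner_integral_le[OF bounded_seminorm_norm sb]
      by (simp add: simple_bochner_integral_diff u_sbi)
    also have "\<dots> \<le> (\<integral>\<^sup>+x. h x \<partial>M) + 1 * e j"
      unfolding e_def
    proof (rule nn_integral_le_add_cmult[OF h(1) meas])
      show "AE x in M. ennreal (norm (u i x - u j x)) \<le> h x + 1 * ennreal (norm (f x - u j x))"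
        using h(2)
      proof eventually_elim
        case (elim x)
        have "norm (u i x - u j x) \<le> norm (f x - u i x) + norm (f x - u j x)"
          using norm_triangle_ineq4[of "f x - u j x" "f x - u i x"] by simp
        then show ?case
          unfolding elim[symmetric] by (simp flip: ennreal_plus)
      qed
    qed
    also have "(\<integral>\<^sup>+x. h x \<partial>M) = e i"
      unfolding e_def using h(2) by (intro nn_integral_cong_AE) (auto elim: eventually_mono)
    finally show ?thesis by simp
  qed
  have "Cauchy (\<lambda>i. simple_bochner_integral M (u i))"
  proof (rule metric_CauchyI)
    fix r :: real assume r: "r > 0"
    have "eventually (\<lambda>i. e i < ennreal (r / 2)) sequentially"
      using r by (intro order_tendstoD(2)[OF e]) auto
    then obtain N where N: "\<And>i. i \<ge> N \<Longrightarrow> e i < ennreal (r / 2)"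
      by (auto simp: eventually_sequentially)
    show "\<exists>N. \<forall>m\<ge>N. \<forall>n\<ge>N. dist (simple_bochner_integral M (u m)) (simple_bochner_integral M (u n)) < r"
    proof (intro exI allI impI)
      fix m n assume "m \<ge> N" "n \<ge> N"
      then have "e m + e n < ennreal (r / 2) + ennreal (r / 2)"
        by (intro add_strict_mono N)
      also have "\<dots> = ennreal r" using r by (simp flip: ennreal_plus)
      finally have "ennreal (norm (simple_bochner_integral M (u m) - simple_bochner_integral M (u n))) < ennreal r"
        using diff by (rule order.strict_trans1[rotated])
      then show "dist (simple_bochner_integral M (u m)) (simple_bochner_integral M (u n)) < r"
        by (simp add: dist_norm ennreal_less_iff)
    qed
  qed
  then obtain I where "(\<lambda>i. simple_bochner_integral M (u i)) \<longlonglongrightarrow> I"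
    by (auto simp: Cauchy_convergent_iff convergent_def)
  then show ?thesis
    using has_banach_integralI[OF f u_sbi e[unfolded e_def]] by blast
qed

section \<open>Uniform boundedness and strongly continuous operator families\<close>

text \<open>By Baire, one of the closed sets \<open>S n\<close> covering the space contains a ball.
  Differences of points of that ball reach every direction, which turns the bound \<open>n\<close>
  on the ball into a bound on operator norms.\<close>

lemma uniform_boundedness:
  fixes F :: "'i \<Rightarrow> 'a::banach \<Rightarrow>\<^sub>L 'b::real_normed_vector"
  assumes bdd: "\<And>x. bounded ((\<lambda>i. F i x) ` A)"
  shows "bounded (F ` A)"
proof -
  define S where "S n = {x. \<forall>i\<in>A. norm (F i x) \<le> real n}" for n
  have cl: "closed (S n)" for n
  proof -
    have "S n = (\<Inter>i\<in>A. {x. norm (F i x) \<le> real n})"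
      by (auto simp: S_def)
    then show ?thesis
      by (auto intro!: closed_INT closed_Collect_le continuous_intros)
  qed
  have "(\<Union>n. S n) = UNIV"
  proof (intro equalityI subset_UNIV subsetI)
    fix x
    obtain B where "\<forall>v\<in>(\<lambda>i. F i x) ` A. norm v \<le> B"
      using bdd[of x] unfolding bounded_iff by blast
    then have "x \<in> S (nat \<lceil>B\<rceil>)"
      unfolding S_def by (auto intro: order_trans[OF _ real_nat_ceiling_ge])
    then show "x \<in> (\<Union>n. S n)" by blast
  qed
  moreover have "(euclidean :: 'a topology) interior_of \<Union>(range S) = {}" if "\<And>n. interior (S n) = {}"
    using that cl completely_metrizable_space_euclidean by (intro Baire_category_alt) auto
  ultimately have "\<exists>n. interior (S n) \<noteq> {}"
    by auto
  then obtain n x0 where "x0 \<in> interior (S n)" by blast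
  then obtain r where r: "r > 0" "cball x0 r \<subseteq> S n"
    by (auto simp: mem_interior_cball)
  have "norm (F i) \<le> 2 * real n / r" if "i \<in> A" for i
  proof (rule norm_blinfun_bound)
    fix v
    show "norm (F i v) \<le> 2 * real n / r * norm v"
    proof (cases "v = 0")
      case False
      \<comment> \<open>Length \<open>r\<close> keeps \<open>x0 + w\<close> in the ball. The two
        points \<open>x0 + w\<close> and \<open>x0\<close> give the factor 2, undoing the scaling
        gives the division by \<open>r\<close>.\<close>
      define w where "w = (r / norm v) *\<^sub>R v"
      have "norm w = r" using r False by (simp add: w_def)
      then have "x0 + w \<in> S n" "x0 \<in> S n"
        using r by (auto intro!: subsetD[OF r(2)] simp: dist_norm)
      then have "norm (F i (x0 + w) - F i x0) \<le> 2 * real n"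
        using that norm_triangle_ineq4[of "F i (x0 + w)" "F i x0"] by (force simp: S_def)
      then have "norm (F i w) \<le> 2 * real n"
        by (simp add: blinfun.add_right)
      then have "(r / norm v) * norm (F i v) \<le> 2 * real n"
        using r by (simp add: w_def blinfun.scaleR_right)
      then show ?thesis using r False by (simp add: field_simps)
    qed simp
  qed (use r in simp)
  then show ?thesis unfolding bounded_iff by blast
qed

lemma bochner_measurable_lebesgue_on_subset:
  assumes y: "bochner_measurable (lebesgue_on S') y"
    and S: "S \<in> sets lebesgue" "S' \<in> sets lebesgue" "S \<subseteq> S'"
  shows "bochner_measurable (lebesgue_on S) y"
proof -
  obtain s where s: "\<And>i. simple_function (lebesgue_on S') (s i)"
    and lim: "AE x in lebesgue_on S'. (\<lambda>i::nat. s i x) \<longlonglongrightarrow> y x"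
    using y unfolding bochner_measurable_def by blast
  have "simple_function (lebesgue_on S) (s i)" for i
  proof -
    have "simple_function lebesgue (\<lambda>x. indicator S' x *\<^sub>R s i x)"
      using s[of i] S by (simp add: simple_function_restrict_space)
    moreover have "simple_function lebesgue (indicator S :: _ \<Rightarrow> real)"
      using S by (intro simple_function_indicator)
    ultimately have "simple_function lebesgue (\<lambda>x. (indicator S x :: real) *\<^sub>R (indicator S' x *\<^sub>R s i x))"
      by (rule simple_function_compose2[where h="(*\<^sub>R)", rotated])
    moreover have "(\<lambda>x. (indicator S x :: real) *\<^sub>R (indicator S' x *\<^sub>R s i x)) = (\<lambda>x. indicator S x *\<^sub>R s i x)"
      using S by (auto simp: indicator_def fun_eq_iff)
    ultimately show ?thesis
      using S by (simp add: simple_function_restrict_space)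
  qed
  moreover have "AE x in lebesgue_on S. (\<lambda>i::nat. s i x) \<longlonglongrightarrow> y x"
    using lim S by (auto simp: AE_restrict_space_iff elim: eventually_mono)
  ultimately show ?thesis unfolding bochner_measurable_def by blast
qed

text \<open>\<open>G\<close> is only strongly continuous. The common bound \<open>L\<close> from
  uniform boundedness decouples the two approximations: it controls \<open>G (g i \<tau>)\<close> on
  \<open>s i \<tau> - y \<tau>\<close>, and strong continuity is used at the fixed vector
  \<open>y \<tau>\<close>.\<close>

lemma bochner_measurable_blinfun_apply:
  fixes G :: "real \<Rightarrow> 'a::banach \<Rightarrow>\<^sub>L 'b::banach"
  assumes y: "bochner_measurable (lebesgue_on {a..b}) y"
    and cont: "\<And>v. continuous_on {a..b} (\<lambda>\<tau>. G \<tau> v)"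
  shows "bochner_measurable (lebesgue_on {a..b}) (\<lambda>\<tau>. G \<tau> (y \<tau>))"
proof -
  obtain s where s: "\<And>i. simple_function (lebesgue_on {a..b}) (s i)"
    and lim: "AE x in lebesgue_on {a..b}. (\<lambda>i::nat. s i x) \<longlonglongrightarrow> y x"
    using y unfolding bochner_measurable_def by blast
  have "bounded (G ` {a..b})"
    by (intro uniform_boundedness compact_imp_bounded compact_continuous_image cont) auto
  then obtain L where L: "\<And>\<tau>. \<tau> \<in> {a..b} \<Longrightarrow> norm (G \<tau>) \<le> L"
    unfolding bounded_iff by blast
  \<comment> \<open>Discretising \<open>G\<close> in time makes the approximants simple functions, so no approximation of
    limits of simple functions by simple functions is needed.\<close>
  define g where "g i \<tau> = max a (of_int \<lfloor>\<tau> * real (Suc i)\<rfloor> / real (Suc i))" for i \<tau>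
  \<comment> \<open>Rounding down stays below \<open>b\<close> but may fall below \<open>a\<close>;
    \<open>max a\<close> repairs this without moving away from \<open>\<tau>\<close>.\<close>
  have g_in: "g i \<tau> \<in> {a..b}" and g_near: "norm (g i \<tau> - \<tau>) \<le> 1 / real (Suc i)" if "\<tau> \<in> {a..b}" for i \<tau>
  proof -
    have 1: "of_int \<lfloor>\<tau> * real (Suc i)\<rfloor> / real (Suc i) \<le> \<tau>"
      by (simp add: divide_le_eq del: of_nat_Suc)
    have "\<tau> * real (Suc i) \<le> of_int \<lfloor>\<tau> * real (Suc i)\<rfloor> + 1"
      by linarith
    then have 2: "\<tau> \<le> of_int \<lfloor>\<tau> * real (Suc i)\<rfloor> / real (Suc i) + 1 / real (Suc i)"
      by (simp add: field_simps del: of_nat_Suc)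
    show "g i \<tau> \<in> {a..b}" using 1 that by (auto simp: g_def)
    show "norm (g i \<tau> - \<tau>) \<le> 1 / real (Suc i)" using 1 2 that by (auto simp: g_def)
  qed
  have g: "simple_function (lebesgue_on {a..b}) (g i)" for i
  proof (rule simple_function_borel_measurable)
    have "g i \<in> borel_measurable borel" unfolding g_def by measurable
    then show "g i \<in> borel_measurable (lebesgue_on {a..b})"
      by (intro measurable_restrict_space1 measurable_completion) simp
    have "g i ` {a..b} \<subseteq> (\<lambda>k. max a (of_int k / real (Suc i))) ` {\<lfloor>a * real (Suc i)\<rfloor>..\<lfloor>b * real (Suc i)\<rfloor>}"
      by (auto simp: g_def intro!: imageI floor_mono mult_right_mono)
    from finite_subset[OF this] show "finite (g i ` space (lebesgue_on {a..b}))"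
      by simp
  qed
  have "AE \<tau> in lebesgue_on {a..b}. (\<lambda>i. G (g i \<tau>) (s i \<tau>)) \<longlonglongrightarrow> G \<tau> (y \<tau>)"
    using lim AE_space
  proof eventually_elim
    case (elim \<tau>)
    then have \<tau>: "\<tau> \<in> {a..b}" by simp
    have "(\<lambda>i. g i \<tau>) \<longlonglongrightarrow> \<tau>"
    proof (rule LIM_zero_cancel, rule Lim_null_comparison)
      show "eventually (\<lambda>i. norm (g i \<tau> - \<tau>) \<le> 1 / real (Suc i)) sequentially"
        using g_near[OF \<tau>] by simp
      show "(\<lambda>i. 1 / real (Suc i)) \<longlonglongrightarrow> 0"
        using LIMSEQ_inverse_real_of_nat by (simp add: inverse_eq_divide)
    qed
    then have lim_g: "(\<lambda>i. G (g i \<tau>) (y \<tau>)) \<longlonglongrightarrow> G \<tau> (y \<tau>)"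
      by (rule continuous_on_tendsto_compose[OF cont _ \<tau>]) (use g_in[OF \<tau>] in simp)
    have lim0: "(\<lambda>i. L * norm (s i \<tau> - y \<tau>)) \<longlonglongrightarrow> 0"
      using tendsto_mult_left[OF tendsto_norm[OF LIM_zero[OF elim(1)]], of L] by simp
    have "norm (G (g i \<tau>) (s i \<tau> - y \<tau>)) \<le> L * norm (s i \<tau> - y \<tau>)" for i
      using norm_blinfun[of "G (g i \<tau>)" "s i \<tau> - y \<tau>"] L[OF g_in[OF \<tau>, of i]]
      by (meson mult_right_mono norm_ge_zero order_trans)
    then have "(\<lambda>i. G (g i \<tau>) (s i \<tau> - y \<tau>)) \<longlonglongrightarrow> 0"
      by (intro Lim_null_comparison[OF always_eventually lim0] allI)
    from tendsto_add[OF this lim_g] show ?case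
      by (simp add: blinfun.diff_right)
  qed
  moreover have "simple_function (lebesgue_on {a..b}) (\<lambda>\<tau>. G (g i \<tau>) (s i \<tau>))" for i
    using g s by (rule simple_function_compose2)
  ultimately show ?thesis
    unfolding bochner_measurable_def by (intro exI[of _ "\<lambda>i \<tau>. G (g i \<tau>) (s i \<tau>)"]) simp
qed

text \<open>Passes from the Lebesgue integral of the majorant to a gauge integral, which the
  fundamental theorem of calculus can evaluate.\<close>

lemma (in bounded_seminorm) has_banach_integral_le_interval:
  assumes I: "has_banach_integral (lebesgue_on {a..b::real}) f I"
    and cont: "continuous_on {a..b} g" and G: "(g has_integral G) {a..b}"
    and nn: "\<And>\<tau>. \<tau> \<in> {a..b} \<Longrightarrow> 0 \<le> g \<tau>"
    and le: "AE \<tau> in lebesgue_on {a..b}. p (f \<tau>) \<le> g \<tau>"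
  shows "p I \<le> G"
proof -
  have "ennreal (p I) \<le> (\<integral>\<^sup>+\<tau>. ennreal (g \<tau>) \<partial>lebesgue_on {a..b})"
  proof (rule has_banach_integral_le[OF I])
    show "(\<lambda>\<tau>. ennreal (g \<tau>)) \<in> borel_measurable (lebesgue_on {a..b})"
      using continuous_imp_measurable_on_sets_lebesgue[OF cont] by simp
    show "AE \<tau> in lebesgue_on {a..b}. ennreal (p (f \<tau>)) \<le> ennreal (g \<tau>)"
      using le by eventually_elim (rule ennreal_leI)
  qed
  also have "\<dots> = (\<integral>\<^sup>+\<tau>. ennreal (g \<tau>) * indicator {a..b} \<tau> \<partial>lborel)"
    by (simp add: nn_integral_restrict_space nn_integral_completion)
  also have "\<dots> = ennreal G"
    using nn G by (rule nn_integral_has_integral_lebesgue')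
  finally show ?thesis
    using has_integral_nonneg[OF G nn] by (simp add: ennreal_le_iff)
qed

lemma monotone_has_derivative_nonneg:
  fixes f :: "real \<Rightarrow> real"
  assumes mono: "\<And>s t. a \<le> s \<Longrightarrow> s \<le> t \<Longrightarrow> f s \<le> f t"
    and der: "(f has_real_derivative d) (at t within {a..})" and t: "a \<le> t"
  shows "0 \<le> d"
proof (rule tendsto_lowerbound)
  show "((\<lambda>x. (f x - f t) / (x - t)) \<longlongrightarrow> d) (at t within {a..})"
    using der by (simp add: has_field_derivative_iff)
  have "0 \<le> (f x - f t) / (x - t)" if "x \<in> {a..}" for x
    using mono[of x t] mono[of t x] that t
    by (cases "x \<le> t") (auto intro: divide_nonpos_nonpos divide_nonneg_nonneg)
  then show "eventually (\<lambda>x. 0 \<le> (f x - f t) / (x - t)) (at t within {a..})"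
    by (auto simp: eventually_at_filter)
  \<comment> \<open>At \<open>t = a\<close> only points to the right are available, so nontriviality
    of the filter is taken from \<open>at_right t\<close>.\<close>
  have "at_right t \<le> at t within {a..}"
    using t by (intro at_le) auto
  then show "at t within {a..} \<noteq> bot"
    using trivial_limit_at_right_real[of t] by (auto simp: bot_unique)
qed

section \<open>Dichotomous evolution families\<close>

text \<open>The constants \<open>lam\<close> and \<open>D\<close>, existentially bound in
  \<open>rho_dichotomy\<close>, become parameters, so that all estimates can refer to the same
  ones.\<close>

locale dichotomous_family =
  fixes T :: "real \<Rightarrow> real \<Rightarrow> 'a::banach \<Rightarrow>\<^sub>L 'a"
    and \<rho> \<rho>' :: "real \<Rightarrow> real"
    and nrm :: "real \<Rightarrow> 'a \<Rightarrow> real"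
    and P :: "real \<Rightarrow> 'a \<Rightarrow>\<^sub>L 'a"
    and C \<epsilon> lam D :: real
  assumes evolution: "evolution_family T"
    and \<rho>_mono: "\<And>s t. 0 \<le> s \<Longrightarrow> s \<le> t \<Longrightarrow> \<rho> s \<le> \<rho> t"
    and \<rho>_deriv: "\<And>t. t \<ge> 0 \<Longrightarrow> (\<rho> has_real_derivative \<rho>' t) (at t within {0..})"
    and \<rho>'_cont: "continuous_on {0..} \<rho>'"
    and \<rho>_top: "filterlim \<rho> at_top at_top"
    and C_pos: "C > 0" and \<epsilon>_nonneg: "\<epsilon> \<ge> 0"
    and nrm_is_norm: "\<And>t. t \<ge> 0 \<Longrightarrow> is_norm (nrm t)"
    and nrm_ge: "\<And>t x. t \<ge> 0 \<Longrightarrow> norm x \<le> nrm t x"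
    and nrm_le: "\<And>t x. t \<ge> 0 \<Longrightarrow> nrm t x \<le> C * exp (\<epsilon> * \<rho> t) * norm x"
    and P_idem: "\<And>t. t \<ge> 0 \<Longrightarrow> P t o\<^sub>L P t = P t"
    and P_comm: "\<And>t s. 0 \<le> s \<Longrightarrow> s \<le> t \<Longrightarrow> T t s o\<^sub>L P s = P t o\<^sub>L T t s"
    and Ker_bij: "\<And>t s. 0 \<le> s \<Longrightarrow> s \<le> t \<Longrightarrow> bij_betw (T t s) (Ker (P s)) (Ker (P t))"
    and lam_pos: "lam > 0" and D_pos: "D > 0"
    and stable: "\<And>t s x. 0 \<le> s \<Longrightarrow> s \<le> t \<Longrightarrow>
      nrm t (T t s (P s x)) \<le> D * exp (- lam * (\<rho> t - \<rho> s)) * nrm s x"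
    and unstable: "\<And>t s x. 0 \<le> t \<Longrightarrow> t \<le> s \<Longrightarrow>
      nrm t (backward T P t s (x - P s x)) \<le> D * exp (- lam * (\<rho> s - \<rho> t)) * nrm s x"
begin

lemma T_id: "t \<ge> 0 \<Longrightarrow> T t t x = x"
  using evolution unfolding evolution_family_def by auto

lemma T_comp: "0 \<le> r \<Longrightarrow> r \<le> s \<Longrightarrow> s \<le> t \<Longrightarrow> T t s (T s r x) = T t r x"
  using evolution unfolding evolution_family_def by (metis blinfun_apply_blinfun_compose)

lemma T_cont_left: "0 \<le> s \<Longrightarrow> continuous_on {s..} (\<lambda>t. T t s x)"
  and T_cont_right: "0 \<le> s \<Longrightarrow> continuous_on {0..s} (\<lambda>t. T s t x)"
  using evolution unfolding evolution_family_def by auto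

lemma P_P: "t \<ge> 0 \<Longrightarrow> P t (P t x) = P t x"
  by (metis P_idem blinfun_apply_blinfun_compose)

lemma T_P: "0 \<le> s \<Longrightarrow> s \<le> t \<Longrightarrow> T t s (P s x) = P t (T t s x)"
  by (metis P_comm blinfun_apply_blinfun_compose)

lemma bounded_seminorm_nrm: "t \<ge> 0 \<Longrightarrow> bounded_seminorm (nrm t) (C * exp (\<epsilon> * \<rho> t))"
  using nrm_is_norm[of t] nrm_le[of t] C_pos
  by unfold_locales (auto simp: is_norm_def)

lemma nrm_nonneg: "t \<ge> 0 \<Longrightarrow> 0 \<le> nrm t x"
  using order_trans[OF norm_ge_zero nrm_ge] .

lemma bounded_seminorm_compose:
  assumes "t \<ge> 0" "linear A" "\<And>x. nrm t (A x) \<le> c * norm x" "0 \<le> c"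
  shows "bounded_seminorm (\<lambda>x. nrm t (A x)) c"
proof -
  interpret n: bounded_seminorm "nrm t" "C * exp (\<epsilon> * \<rho> t)"
    using assms(1) by (rule bounded_seminorm_nrm)
  show ?thesis
    using assms(3,4) n.triangle n.scale
    by unfold_locales (auto simp: linear_add[OF assms(2)] linear_cmul[OF assms(2)])
qed

text \<open>\<open>v - P n v\<close> lies in \<open>Ker (P n)\<close>, so \<open>inv_into\<close> is never applied outside the image here.\<close>

definition B :: "real \<Rightarrow> real \<Rightarrow> 'a \<Rightarrow> 'a" where
  "B t n v = backward T P t n (v - P n v)"

lemma complement_in_Ker: "n \<ge> 0 \<Longrightarrow> v - P n v \<in> Ker (P n)"
  by (simp add: Ker_def blinfun.diff_right P_P)

lemma
  assumes "0 \<le> t" "t \<le> n"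
  shows P_B: "P t (B t n v) = 0" and T_B: "T n t (B t n v) = v - P n v"
proof -
  have im: "T n t ` Ker (P t) = Ker (P n)"
    using Ker_bij[OF assms] by (rule bij_betw_imp_surj_on)
  have Q: "v - P n v \<in> T n t ` Ker (P t)"
    unfolding im using assms by (intro complement_in_Ker) simp
  show "P t (B t n v) = 0"
    using inv_into_into[OF Q] by (simp add: B_def backward_def Ker_def)
  show "T n t (B t n v) = v - P n v"
    using f_inv_into_f[OF Q] by (simp add: B_def backward_def)
qed

text \<open>Injectivity of \<open>T n t\<close> on \<open>Ker (P t)\<close> makes \<open>P_B\<close>
  and \<open>T_B\<close> a characterisation of \<open>B t n v\<close>. The algebraic laws of
  \<open>B\<close> below are all checked through it.\<close>

lemma B_eqI:
  assumes "0 \<le> t" "t \<le> n" "P t u = 0" "T n t u = v - P n v"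
  shows "B t n v = u"
  using bij_betw_imp_inj_on[OF Ker_bij[OF assms(1,2)]] P_B[OF assms(1,2), of v] T_B[OF assms(1,2), of v] assms(3,4)
  by (auto simp: inj_on_def Ker_def)

lemma linear_B: "0 \<le> t \<Longrightarrow> t \<le> n \<Longrightarrow> linear (B t n)"
  by (intro linearI B_eqI) (simp_all add: blinfun.bilinear_simps P_B T_B algebra_simps)

lemma nrm_B: "0 \<le> t \<Longrightarrow> t \<le> n \<Longrightarrow> nrm t (B t n v) \<le> D * exp (- lam * (\<rho> n - \<rho> t)) * nrm n v"
  unfolding B_def by (rule unstable)

lemma nrm_B_le:
  assumes "0 \<le> t" "t \<le> n"
  shows "nrm t (B t n v) \<le> D * nrm n v"
proof -
  have "exp (- lam * (\<rho> n - \<rho> t)) \<le> 1"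
    using lam_pos \<rho>_mono[OF assms] by (simp add: mult_nonneg_nonneg)
  then have "D * exp (- lam * (\<rho> n - \<rho> t)) * nrm n v \<le> D * 1 * nrm n v"
    using D_pos assms by (intro mult_right_mono mult_left_mono nrm_nonneg) auto
  then show ?thesis using nrm_B[OF assms, of v] by simp
qed

lemma B_self: "0 \<le> t \<Longrightarrow> B t t v = v - P t v"
  by (intro B_eqI) (auto simp: T_id blinfun.diff_right P_P)

text \<open>\<open>T m n\<close> intertwines the projections, so going on to \<open>m\<close> before
  returning to \<open>t\<close> changes nothing. Under the integral this replaces
  \<open>B n m (T m \<tau> (y \<tau>))\<close> by \<open>B n \<tau> (y \<tau>)\<close>, where the
  decay from \<open>\<tau>\<close> to \<open>n\<close> is available.\<close>

lemma B_T:
  assumes "0 \<le> t" "t \<le> n" "n \<le> m"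
  shows "B t m (T m n v) = B t n v"
proof (rule B_eqI)
  have "T m t (B t n v) = T m n (T n t (B t n v))"
    using assms by (simp add: T_comp)
  then show "T m t (B t n v) = T m n v - P m (T m n v)"
    using assms by (simp add: T_B blinfun.diff_right T_P)
qed (use assms P_B in auto)

lemma T_B_B:
  assumes "0 \<le> s" "s \<le> t" "t \<le> n"
  shows "T t s (B s n v) = B t n v"
proof (rule B_eqI[symmetric])
  show "P t (T t s (B s n v)) = 0"
    using assms T_P[of s t "B s n v"] by (simp add: P_B blinfun.zero_right)
  show "T n t (T t s (B s n v)) = v - P n v"
    using assms by (simp add: T_comp T_B)
qed (use assms in auto)

lemma B_B:
  assumes "0 \<le> t" "t \<le> n" "n \<le> m"
  shows "B t n (B n m v) = B t m v"
  using assms by (intro B_eqI) (auto simp: P_B T_B_B)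

text \<open>The dichotomy does not bound \<open>T t s\<close> on \<open>Ker (P s)\<close> forwards in time. There \<open>T t s\<close> factors as
  \<open>B t t0\<close> after \<open>T t0 s\<close>, where \<open>B t t0\<close> is controlled by the dichotomy and \<open>T t0 s\<close>, with \<open>t0\<close>
  fixed, by uniform boundedness.\<close>

lemma T_bounded_triangle:
  obtains L where "L \<ge> 0"
    "\<And>t s x. 0 \<le> s \<Longrightarrow> s \<le> t \<Longrightarrow> t \<le> t0 \<Longrightarrow> norm (T t s x) \<le> L * norm x"
proof (cases "t0 \<ge> 0")
  case True
  have "bounded (T t0 ` {0..t0})"
    by (intro uniform_boundedness compact_imp_bounded compact_continuous_image T_cont_right True) auto
  then obtain M where M: "\<And>s. s \<in> {0..t0} \<Longrightarrow> norm (T t0 s) \<le> M"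
    unfolding bounded_iff by blast
  \<comment> \<open>Monotonicity of \<open>\<rho>\<close> makes the constant at \<open>t0\<close>
    serve every \<open>nrm t\<close> with \<open>t \<le> t0\<close>.\<close>
  define N where "N = C * exp (\<epsilon> * \<rho> t0)"
  have N: "nrm t x \<le> N * norm x" if "0 \<le> t" "t \<le> t0" for t x
  proof -
    have "C * exp (\<epsilon> * \<rho> t) * norm x \<le> N * norm x"
      unfolding N_def using C_pos \<epsilon>_nonneg \<rho>_mono[OF that]
      by (intro mult_right_mono mult_left_mono) (auto intro: mult_left_mono)
    then show ?thesis using nrm_le[of t x] that by simp
  qed
  have M0: "M \<ge> 0" using M[of 0] True norm_ge_zero order_trans by (metis atLeastAtMost_iff order_refl)
  have N0: "N \<ge> 0" using C_pos by (simp add: N_def)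
  have bound: "norm (T t s x) \<le> (D * N + D * N * M) * norm x" if "0 \<le> s" "s \<le> t" "t \<le> t0" for t s x
  proof -
    have "T t s x - P t (T t s x) = B t t0 (T t0 s x)"
      using that B_T[of t t t0 "T t s x"] by (simp add: B_self T_comp)
    then have eq: "T t s x = T t s (P s x) + B t t0 (T t0 s x)"
      using that by (simp add: T_P algebra_simps)
    have "norm (T t s (P s x)) \<le> nrm t (T t s (P s x))"
      using that by (intro nrm_ge) simp
    also have "\<dots> \<le> D * exp (- lam * (\<rho> t - \<rho> s)) * nrm s x"
      using that by (intro stable)
    also have "\<dots> \<le> D * 1 * (N * norm x)"
      using that D_pos lam_pos \<rho>_mono[of s t]
      by (intro mult_mono N nrm_nonneg) (auto intro: mult_nonneg_nonneg)
    finally have 1: "norm (T t s (P s x)) \<le> D * N * norm x" by simp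
    have "norm (B t t0 (T t0 s x)) \<le> nrm t (B t t0 (T t0 s x))"
      using that by (intro nrm_ge) simp
    also have "\<dots> \<le> D * nrm t0 (T t0 s x)"
      using that by (intro nrm_B_le) auto
    also have "\<dots> \<le> D * (N * (M * norm x))"
    proof -
      have "norm (T t0 s x) \<le> M * norm x"
        using norm_blinfun[of "T t0 s" x] M[of s] that
        by (meson atLeastAtMost_iff mult_right_mono norm_ge_zero order_trans)
      then have "N * norm (T t0 s x) \<le> N * (M * norm x)"
        using N0 by (rule mult_left_mono)
      then show ?thesis
        using N[of t0 "T t0 s x"] True D_pos by (intro mult_left_mono) auto
    qed
    finally have "norm (B t t0 (T t0 s x)) \<le> D * N * M * norm x" by (simp add: mult.assoc)
    then show ?thesis
      using 1 norm_triangle_ineq[of "T t s (P s x)" "B t t0 (T t0 s x)"] eq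
      by (simp add: algebra_simps)
  qed
  show ?thesis
    by (rule that[OF _ bound]) (use D_pos N0 M0 in auto)
next
  case False
  show ?thesis by (rule that[of 0]) (use False in auto)
qed

section \<open>The weight \<open>\<rho>'\<close>\<close>

lemma \<rho>'_nonneg: "t \<ge> 0 \<Longrightarrow> 0 \<le> \<rho>' t"
  using monotone_has_derivative_nonneg[OF \<rho>_mono \<rho>_deriv] by blast

lemma \<rho>_cont: "continuous_on {0..} \<rho>"
  using \<rho>_deriv by (intro DERIV_continuous_on) auto

text \<open>The substitution \<open>u = \<rho> \<tau>\<close> makes the integral explicit. It is
  applied with \<open>k = D * K\<close>, and with \<open>c = lam\<close> on the stable side,
  \<open>c = - lam\<close> on the unstable side.\<close>

lemma exp_weight_integral:
  assumes "0 \<le> a" "a \<le> b" "c \<noteq> 0"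
  shows "((\<lambda>\<tau>. \<rho>' \<tau> * (k * exp (c * (\<rho> \<tau> - d)))) has_integral
      (k / c * exp (c * (\<rho> b - d)) - k / c * exp (c * (\<rho> a - d)))) {a..b}"
proof (rule fundamental_theorem_of_calculus[OF assms(2)])
  fix \<tau> assume \<tau>: "\<tau> \<in> {a..b}"
  have [derivative_intros]: "(\<rho> has_real_derivative \<rho>' \<tau>) (at \<tau> within {a..b})"
    using \<rho>_deriv[of \<tau>] \<tau> assms(1) by (auto intro: DERIV_subset)
  show "((\<lambda>\<tau>. k / c * exp (c * (\<rho> \<tau> - d))) has_vector_derivative
      \<rho>' \<tau> * (k * exp (c * (\<rho> \<tau> - d)))) (at \<tau> within {a..b})"
    unfolding has_real_derivative_iff_has_vector_derivative[symmetric]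
    by (rule derivative_eq_intros refl | use assms(3) in simp)+
qed

end

section \<open>The integral term of the equation and its bounds\<close>

locale dichotomous_equation = dichotomous_family +
  fixes y :: "real \<Rightarrow> 'a" and K :: real
  assumes y_meas: "bochner_measurable (lebesgue_on {0..}) y"
    and y_bound: "AE \<tau> in lebesgue_on {0..}. nrm \<tau> (y \<tau>) \<le> K"
    and K_nonneg: "0 \<le> K"
begin

lemma y_bound_interval: "0 \<le> s \<Longrightarrow> AE \<tau> in lebesgue_on {s..t}. nrm \<tau> (y \<tau>) \<le> K"
  using y_bound by (auto simp: AE_restrict_space_iff elim!: eventually_mono)

definition integrand :: "real \<Rightarrow> real \<Rightarrow> 'a" where
  "integrand t \<tau> = \<rho>' \<tau> *\<^sub>R T t \<tau> (y \<tau>)"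

text \<open>For \<open>0 \<le> s \<le> t\<close> the description is proper by
  \<open>has_integral_J\<close>.\<close>

definition J :: "real \<Rightarrow> real \<Rightarrow> 'a" where
  "J s t = (THE I. has_banach_integral (lebesgue_on {s..t}) (integrand t) I)"

lemma \<rho>'_cont_interval: "0 \<le> s \<Longrightarrow> continuous_on {s..t} \<rho>'"
  by (rule continuous_on_subset[OF \<rho>'_cont]) auto

text \<open>\<open>M\<close> depends on \<open>t0\<close> alone. This gives existence of each
  \<open>J s t\<close>, and also the Lipschitz bound on short intervals behind continuity of
  solutions.\<close>

lemma integrand_bound:
  obtains M where "M \<ge> 0"
    "\<And>s t. 0 \<le> s \<Longrightarrow> t \<le> t0 \<Longrightarrow> AE \<tau> in lebesgue_on {s..t}. norm (integrand t \<tau>) \<le> M"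
proof -
  obtain L where L: "L \<ge> 0"
    "\<And>t s x. 0 \<le> s \<Longrightarrow> s \<le> t \<Longrightarrow> t \<le> t0 \<Longrightarrow> norm (T t s x) \<le> L * norm x"
    by (rule T_bounded_triangle[of t0]) (rule that)
  have "bounded (\<rho>' ` {0..t0})"
    by (intro compact_imp_bounded compact_continuous_image \<rho>'_cont_interval) auto
  then obtain R where R: "\<And>\<tau>. \<tau> \<in> {0..t0} \<Longrightarrow> norm (\<rho>' \<tau>) \<le> R"
    unfolding bounded_iff by blast
  show ?thesis
  proof
    \<comment> \<open>\<open>R\<close> may be negative when \<open>t0 < 0\<close> leaves no
      \<open>\<tau>\<close> to bound.\<close>
    show "0 \<le> \<bar>R\<bar> * (L * K)" using L K_nonneg by simp
    fix s t :: real assume st: "0 \<le> s" "t \<le> t0"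
    show "AE \<tau> in lebesgue_on {s..t}. norm (integrand t \<tau>) \<le> \<bar>R\<bar> * (L * K)"
      using y_bound_interval[OF st(1)] AE_space
    proof eventually_elim
      case (elim \<tau>)
      then have \<tau>: "s \<le> \<tau>" "\<tau> \<le> t" by auto
      have "norm (y \<tau>) \<le> K"
        using elim(1) nrm_ge[of \<tau> "y \<tau>"] \<tau> st by linarith
      then have "norm (T t \<tau> (y \<tau>)) \<le> L * K"
        using L(2)[of \<tau> t "y \<tau>"] \<tau> st mult_left_mono[OF _ L(1), of "norm (y \<tau>)" K] by linarith
      moreover have "\<bar>\<rho>' \<tau>\<bar> \<le> \<bar>R\<bar>"
        using R[of \<tau>] \<tau> st by simp
      ultimately show ?case
        by (simp add: integrand_def mult_mono)
    qed
  qed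
qed

lemma has_integral_J:
  assumes "0 \<le> s" "s \<le> t"
  shows "has_banach_integral (lebesgue_on {s..t}) (integrand t) (J s t)"
proof -
  have "bochner_measurable (lebesgue_on {s..t}) (\<lambda>\<tau>. (\<rho>' \<tau> *\<^sub>R T t \<tau>) (y \<tau>))"
  proof (rule bochner_measurable_blinfun_apply)
    show "bochner_measurable (lebesgue_on {s..t}) y"
      using assms by (intro bochner_measurable_lebesgue_on_subset[OF y_meas]) auto
    have "continuous_on {s..t} (\<lambda>\<tau>. T t \<tau> v)" for v
      using assms by (intro continuous_on_subset[OF T_cont_right]) auto
    then show "continuous_on {s..t} (\<lambda>\<tau>. (\<rho>' \<tau> *\<^sub>R T t \<tau>) v)" for v
      unfolding blinfun.scaleR_left using assms by (intro continuous_on_scaleR \<rho>'_cont_interval)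
  qed
  then have meas: "bochner_measurable (lebesgue_on {s..t}) (integrand t)"
    by (simp add: integrand_def[abs_def] blinfun.scaleR_left)
  obtain M where M: "AE \<tau> in lebesgue_on {s..t}. norm (integrand t \<tau>) \<le> M"
    by (rule integrand_bound[of t]) (use assms(1) in blast)
  have "\<exists>I. has_banach_integral (lebesgue_on {s..t}) (integrand t) I"
    by (rule has_banach_integral_exists[OF meas _ M]) (simp add: emeasure_restrict_space emeasure_lborel_Icc_eq)
  then show ?thesis
    unfolding J_def by (metis has_banach_integral_unique the_equality)
qed

text \<open>The bounded operator \<open>T t s\<close> moves under the integral over
  \<open>[r, s]\<close> and turns \<open>integrand s\<close> into \<open>integrand t\<close>; the
  rest is additivity at \<open>s\<close>.\<close>

lemma J_cocycle:
  assumes "0 \<le> r" "r \<le> s" "s \<le> t"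
  shows "J r t = T t s (J r s) + J s t"
proof (rule has_banach_integral_combine[OF assms(2,3)])
  have "has_banach_integral (lebesgue_on {r..s}) (\<lambda>\<tau>. T t s (integrand s \<tau>)) (T t s (J r s))"
    using has_integral_J[OF assms(1,2)] blinfun.bounded_linear_right by (rule has_banach_integral_linear)
  then show "has_banach_integral (lebesgue_on {r..s}) (integrand t) (T t s (J r s))"
    by (rule has_banach_integral_cong_AE)
      (use assms in \<open>auto intro!: AE_I2 simp: integrand_def blinfun.scaleR_right T_comp\<close>)
qed (use assms in \<open>auto intro: has_integral_J\<close>)

lemma J_self: "0 \<le> t \<Longrightarrow> J t t = 0"
  using J_cocycle[of t t t] by (simp add: T_id)

lemma J_bound:
  obtains M where "M \<ge> 0" "\<And>s t. 0 \<le> s \<Longrightarrow> s \<le> t \<Longrightarrow> t \<le> t0 \<Longrightarrow> norm (J s t) \<le> M * (t - s)"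
proof -
  obtain M where M: "M \<ge> 0"
    "\<And>s t. 0 \<le> s \<Longrightarrow> t \<le> t0 \<Longrightarrow> AE \<tau> in lebesgue_on {s..t}. norm (integrand t \<tau>) \<le> M"
    by (rule integrand_bound[of t0]) (rule that)
  have "norm (J s t) \<le> M * (t - s)" if "0 \<le> s" "s \<le> t" "t \<le> t0" for s t
  proof (rule bounded_seminorm.has_banach_integral_le_interval[OF bounded_seminorm_norm has_integral_J])
    show "((\<lambda>_. M) has_integral M * (t - s)) {s..t}"
      using has_integral_const_real[of M s t] that by (simp add: mult.commute)
  qed (use that M in auto)
  with M(1) show ?thesis by (rule that)
qed

text \<open>\<open>P t\<close> carried under the integral becomes
  \<open>T t \<tau> (P \<tau> (y \<tau>))\<close>, to which the stable estimate applies. The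
  antiderivative is \<open>D * K / lam\<close> at the upper end, and its nonnegative value at the
  lower end is dropped.\<close>

lemma nrm_P_J:
  assumes "0 \<le> s" "s \<le> t"
  shows "nrm t (P t (J s t)) \<le> D * K / lam"
proof -
  have t: "t \<ge> 0" using assms by simp
  have "bounded_seminorm (\<lambda>x. nrm t (P t x)) (C * exp (\<epsilon> * \<rho> t) * norm (P t))"
  proof (rule bounded_seminorm_compose[OF t])
    fix x
    have "C * exp (\<epsilon> * \<rho> t) * norm (P t x) \<le> C * exp (\<epsilon> * \<rho> t) * (norm (P t) * norm x)"
      using C_pos by (intro mult_left_mono norm_blinfun) auto
    then show "nrm t (P t x) \<le> C * exp (\<epsilon> * \<rho> t) * norm (P t) * norm x"
      using nrm_le[OF t, of "P t x"] by (simp add: mult.assoc)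
  qed (use C_pos in \<open>auto intro: bounded_linear.linear blinfun.bounded_linear_right\<close>)
  then interpret p: bounded_seminorm "\<lambda>x. nrm t (P t x)" "C * exp (\<epsilon> * \<rho> t) * norm (P t)" .
  have "nrm t (P t (J s t)) \<le> D * K / lam * exp (lam * (\<rho> t - \<rho> t)) - D * K / lam * exp (lam * (\<rho> s - \<rho> t))"
  proof (rule p.has_banach_integral_le_interval[OF has_integral_J[OF assms] _ exp_weight_integral])
    show "continuous_on {s..t} (\<lambda>\<tau>. \<rho>' \<tau> * (D * K * exp (lam * (\<rho> \<tau> - \<rho> t))))"
      using assms by (intro continuous_intros \<rho>'_cont_interval continuous_on_subset[OF \<rho>_cont]) auto
    show "0 \<le> \<rho>' \<tau> * (D * K * exp (lam * (\<rho> \<tau> - \<rho> t)))" if "\<tau> \<in> {s..t}" for \<tau>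
      using that assms D_pos K_nonneg by (intro mult_nonneg_nonneg \<rho>'_nonneg) auto
    show "AE \<tau> in lebesgue_on {s..t}. nrm t (P t (integrand t \<tau>)) \<le> \<rho>' \<tau> * (D * K * exp (lam * (\<rho> \<tau> - \<rho> t)))"
      using y_bound_interval[OF assms(1)] AE_space
    proof eventually_elim
      case (elim \<tau>)
      then have \<tau>: "0 \<le> \<tau>" "\<tau> \<le> t" using assms by auto
      have "nrm t (P t (T t \<tau> (y \<tau>))) \<le> D * exp (- lam * (\<rho> t - \<rho> \<tau>)) * nrm \<tau> (y \<tau>)"
        using stable[OF \<tau>] by (simp add: T_P \<tau>)
      also have "\<dots> \<le> D * exp (- lam * (\<rho> t - \<rho> \<tau>)) * K"
        using elim(1) D_pos by (intro mult_left_mono) auto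
      finally have "nrm t (P t (T t \<tau> (y \<tau>))) \<le> D * K * exp (lam * (\<rho> \<tau> - \<rho> t))"
        by (simp add: algebra_simps)
      then show ?case
        using \<rho>'_nonneg[OF \<tau>(1)] by (simp add: integrand_def p.scale mult_left_mono)
    qed
  qed (use assms lam_pos in auto)
  also have "\<dots> \<le> D * K / lam"
    using D_pos K_nonneg lam_pos by simp
  finally show ?thesis .
qed

text \<open>The backward counterpart, with the roles of the end points exchanged: the antiderivative
  for \<open>c = - lam\<close> now contributes \<open>D * K / lam\<close> at the lower end
  \<open>n\<close>. The bound is uniform in \<open>m\<close>, which is what lets \<open>m\<close>
  tend to infinity.\<close>

lemma nrm_B_J:
  assumes "0 \<le> n" "n \<le> m"
  shows "nrm n (B n m (J n m)) \<le> D * K / lam"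
proof -
  have m: "m \<ge> 0" using assms by simp
  have "bounded_seminorm (\<lambda>x. nrm n (B n m x)) (D * (C * exp (\<epsilon> * \<rho> m)))"
  proof (rule bounded_seminorm_compose[OF assms(1) linear_B[OF assms]])
    fix x
    have "D * nrm m x \<le> D * (C * exp (\<epsilon> * \<rho> m) * norm x)"
      using D_pos nrm_le[OF m] by (intro mult_left_mono) auto
    then show "nrm n (B n m x) \<le> D * (C * exp (\<epsilon> * \<rho> m)) * norm x"
      using nrm_B_le[OF assms, of x] by (simp add: mult.assoc)
  qed (use C_pos D_pos in auto)
  then interpret p: bounded_seminorm "\<lambda>x. nrm n (B n m x)" "D * (C * exp (\<epsilon> * \<rho> m))" .
  have "nrm n (B n m (J n m)) \<le> D * K / (- lam) * exp (- lam * (\<rho> m - \<rho> n)) - D * K / (- lam) * exp (- lam * (\<rho> n - \<rho> n))"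
  proof (rule p.has_banach_integral_le_interval[OF has_integral_J[OF assms] _ exp_weight_integral])
    show "continuous_on {n..m} (\<lambda>\<tau>. \<rho>' \<tau> * (D * K * exp (- lam * (\<rho> \<tau> - \<rho> n))))"
      using assms by (intro continuous_intros \<rho>'_cont_interval continuous_on_subset[OF \<rho>_cont]) auto
    show "0 \<le> \<rho>' \<tau> * (D * K * exp (- lam * (\<rho> \<tau> - \<rho> n)))" if "\<tau> \<in> {n..m}" for \<tau>
      using that assms D_pos K_nonneg by (intro mult_nonneg_nonneg \<rho>'_nonneg) auto
    show "AE \<tau> in lebesgue_on {n..m}. nrm n (B n m (integrand m \<tau>)) \<le> \<rho>' \<tau> * (D * K * exp (- lam * (\<rho> \<tau> - \<rho> n)))"
      using y_bound_interval[OF assms(1)] AE_space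
    proof eventually_elim
      case (elim \<tau>)
      then have \<tau>: "0 \<le> \<tau>" "n \<le> \<tau>" "\<tau> \<le> m" using assms by auto
      have "nrm n (B n m (T m \<tau> (y \<tau>))) \<le> D * exp (- lam * (\<rho> \<tau> - \<rho> n)) * nrm \<tau> (y \<tau>)"
        using nrm_B[OF assms(1) \<tau>(2), of "y \<tau>"] by (simp add: B_T assms \<tau>)
      also have "\<dots> \<le> D * exp (- lam * (\<rho> \<tau> - \<rho> n)) * K"
        using elim(1) D_pos by (intro mult_left_mono) auto
      finally have "nrm n (B n m (T m \<tau> (y \<tau>))) \<le> D * K * exp (- lam * (\<rho> \<tau> - \<rho> n))"
        by (simp add: algebra_simps)
      then show ?case
        using \<rho>'_nonneg[OF \<tau>(1)] by (simp add: integrand_def p.scale mult_left_mono)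
    qed
  qed (use assms lam_pos in auto)
  also have "\<dots> \<le> D * K / lam"
    using D_pos K_nonneg lam_pos by simp
  finally show ?thesis .
qed

end

section \<open>Continuity of solutions\<close>

context dichotomous_equation
begin

definition solution :: "(real \<Rightarrow> 'a) \<Rightarrow> bool" where
  "solution x \<longleftrightarrow> (\<forall>t s. 0 \<le> s \<and> s \<le> t \<longrightarrow> x t = T t s (x s) + J s t)"

lemma solutionD: "solution x \<Longrightarrow> 0 \<le> s \<Longrightarrow> s \<le> t \<Longrightarrow> x t = T t s (x s) + J s t"
  by (simp add: solution_def)

text \<open>In \<open>J 0 t\<close> both the interval and the operators \<open>T t \<tau>\<close>
  vary with \<open>t\<close>. Starting instead at \<open>r\<close> just left of \<open>t1\<close>
  treats both sides of \<open>t1\<close> together: the \<open>J\<close> terms are small because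
  their intervals are short, and \<open>T t r (x r)\<close> is continuous in \<open>t\<close> for
  this fixed \<open>r\<close>.\<close>

lemma solution_continuous:
  assumes x: "solution x"
  shows "continuous_on {0..} x"
  unfolding continuous_on_iff
proof (intro ballI allI impI)
  fix t1 e :: real assume t1: "t1 \<in> {0..}" and e: "e > 0"
  obtain M where M: "M \<ge> 0" "\<And>s t. 0 \<le> s \<Longrightarrow> s \<le> t \<Longrightarrow> t \<le> t1 + 1 \<Longrightarrow> norm (J s t) \<le> M * (t - s)"
    by (rule J_bound[of "t1 + 1"]) (rule that)
  \<comment> \<open>The two \<open>J\<close> terms live on lengths at most
    \<open>2 * \<delta>\<close> and \<open>\<delta>\<close>, so together they stay within
    \<open>3 * M * \<delta> < e / 2\<close>. The \<open>+ 1\<close> covers \<open>M = 0\<close>; the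
    minimum with 1 keeps \<open>t\<close> below \<open>t1 + 1\<close>, where \<open>M\<close> is
    valid.\<close>
  define \<delta> where "\<delta> = min 1 (e / (6 * (M + 1)))"
  have \<delta>: "0 < \<delta>" "\<delta> \<le> 1" using e M(1) by (auto simp: \<delta>_def)
  have "\<delta> \<le> e / (6 * (M + 1))" by (simp add: \<delta>_def)
  moreover have "0 < 6 * (M + 1)" using M(1) by simp
  ultimately have "\<delta> * (6 * (M + 1)) \<le> e" by (simp only: pos_le_divide_eq)
  then have M\<delta>: "6 * (M * \<delta>) < e" using \<delta> by (simp add: algebra_simps)
  define r where "r = max 0 (t1 - \<delta>)"
  have r: "0 \<le> r" "r \<le> t1" using t1 \<delta> by (auto simp: r_def)
  obtain d where d: "d > 0"
    "\<And>t. t \<in> {r..} \<Longrightarrow> dist t t1 < d \<Longrightarrow> dist (T t r (x r)) (T t1 r (x r)) < e / 2"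
    using T_cont_left[OF r(1), of "x r"] r e unfolding continuous_on_iff
    by (metis atLeast_iff half_gt_zero)
  show "\<exists>d>0. \<forall>t\<in>{0..}. dist t t1 < d \<longrightarrow> dist (x t) (x t1) < e"
  proof (intro exI[of _ "min d \<delta>"] conjI ballI impI)
    fix t :: real assume t: "t \<in> {0..}" "dist t t1 < min d \<delta>"
    then have t': "r \<le> t" "t \<le> t1 + 1" "t - r \<le> 2 * \<delta>" "t1 - r \<le> \<delta>"
      using \<delta> t1 by (auto simp: r_def dist_real_def abs_if split: if_splits)
    have "x t - x t1 = (T t r (x r) - T t1 r (x r)) + (J r t - J r t1)"
      using solutionD[OF x r(1) t'(1)] solutionD[OF x r] by simp
    then have "norm (x t - x t1) \<le> norm (T t r (x r) - T t1 r (x r)) + (norm (J r t) + norm (J r t1))"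
      using norm_triangle_ineq[of "T t r (x r) - T t1 r (x r)" "J r t - J r t1"]
        norm_triangle_ineq4[of "J r t" "J r t1"] by simp
    moreover have "norm (T t r (x r) - T t1 r (x r)) < e / 2"
      using d(2)[of t] t t' by (simp add: dist_norm)
    moreover have "norm (J r t) \<le> M * (2 * \<delta>)"
      using M(2)[OF r(1) t'(1,2)] mult_left_mono[OF t'(3) M(1)] by linarith
    moreover have "norm (J r t1) \<le> M * \<delta>"
      using M(2)[OF r] mult_left_mono[OF t'(4) M(1)] by simp
    ultimately show "dist (x t) (x t1) < e"
      using M\<delta> by (simp add: dist_norm)
  qed (use d \<delta> in auto)
qed

section \<open>Construction of the bounded solution\<close>

lemma exp_decay:
  assumes "c \<ge> 0" "e > 0"
  obtains N where "N \<ge> t" "c * exp (- lam * (\<rho> N - d)) < e"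
proof -
  have "((\<lambda>s. c * exp (- lam * (\<rho> s - d))) \<longlongrightarrow> c * 0) at_top"
  proof (intro tendsto_mult tendsto_const filterlim_compose[OF exp_at_bot])
    have "filterlim (\<lambda>s. lam * (- d + \<rho> s)) at_top at_top"
      by (rule filterlim_tendsto_pos_mult_at_top[OF tendsto_const lam_pos
            filterlim_tendsto_add_at_top[OF tendsto_const \<rho>_top]])
    then show "filterlim (\<lambda>s. - lam * (\<rho> s - d)) at_bot at_top"
      unfolding filterlim_uminus_at_top by (simp add: algebra_simps)
  qed
  then have "eventually (\<lambda>s. c * exp (- lam * (\<rho> s - d)) < e) at_top"
    using assms(2) by (intro order_tendstoD(2)) auto
  then have "eventually (\<lambda>s. t \<le> s \<and> c * exp (- lam * (\<rho> s - d)) < e) at_top"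
    by (rule eventually_conj[OF eventually_ge_at_top])
  then obtain N where "\<forall>s\<ge>N. t \<le> s \<and> c * exp (- lam * (\<rho> s - d)) < e"
    unfolding eventually_at_top_linorder by blast
  then show ?thesis using that[of N] by simp
qed

text \<open>The difference is the tail \<open>B t m (J n m)\<close>. Factoring it through time
  \<open>n\<close> leaves the uniform bound \<open>D * K / lam\<close> at \<open>n\<close>,
  multiplied by the decay from \<open>n\<close> back to \<open>t\<close>.\<close>

lemma nrm_B_J_le:
  assumes "0 \<le> t" "t \<le> n" "n \<le> m"
  shows "nrm t (B t m (J t m) - B t n (J t n)) \<le> D * (D * K / lam) * exp (- lam * (\<rho> n - \<rho> t))"
proof -
  interpret linear "B t m" using assms by (intro linear_B) auto
  have "B t m (J t m) - B t n (J t n) = B t m (J n m)"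
    using J_cocycle[OF assms] by (simp add: add B_T[OF assms])
  also have "\<dots> = B t n (B n m (J n m))"
    by (rule B_B[OF assms, symmetric])
  finally have "nrm t (B t m (J t m) - B t n (J t n)) \<le> D * exp (- lam * (\<rho> n - \<rho> t)) * nrm n (B n m (J n m))"
    using nrm_B[OF assms(1,2), of "B n m (J n m)"] by simp
  also have "\<dots> \<le> D * exp (- lam * (\<rho> n - \<rho> t)) * (D * K / lam)"
    using D_pos assms by (intro mult_left_mono nrm_B_J) auto
  finally show ?thesis by (simp add: mult_ac)
qed

text \<open>\<open>w t\<close> stands for the improper integral of \<open>\<rho>' \<tau> *\<^sub>R B t \<tau> (y \<tau>)\<close> over \<open>[t, \<infinity>)\<close>.\<close>

definition w :: "real \<Rightarrow> 'a" where
  "w t = lim (\<lambda>n. B t (real n) (J t (real n)))"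

lemma w_tendsto:
  assumes "0 \<le> t"
  shows "(\<lambda>n. B t (real n) (J t (real n))) \<longlonglongrightarrow> w t"
proof -
  have "Cauchy (\<lambda>n. B t (real n) (J t (real n)))"
    unfolding Cauchy_altdef2
  proof (intro allI impI)
    fix e :: real assume e: "e > 0"
    have "0 \<le> D * (D * K / lam)"
      using D_pos K_nonneg lam_pos by simp
    then obtain N where N: "N \<ge> t" "D * (D * K / lam) * exp (- lam * (\<rho> N - \<rho> t)) < e"
      using e by (rule exp_decay)
    show "\<exists>n. \<forall>m\<ge>n. dist (B t (real m) (J t (real m))) (B t (real n) (J t (real n))) < e"
    proof (intro exI allI impI)
      fix m assume m: "m \<ge> nat \<lceil>N\<rceil>"
      let ?n = "real (nat \<lceil>N\<rceil>)"
      have n: "N \<le> ?n" "?n \<le> real m" using m by (simp_all add: real_nat_ceiling_ge)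
      have "norm (B t (real m) (J t (real m)) - B t ?n (J t ?n))
          \<le> D * (D * K / lam) * exp (- lam * (\<rho> ?n - \<rho> t))"
        using nrm_B_J_le[OF assms, of ?n "real m"] nrm_ge[OF assms] n N(1) by (meson order_trans)
      also have "\<dots> \<le> D * (D * K / lam) * exp (- lam * (\<rho> N - \<rho> t))"
        using \<rho>_mono[of N ?n] assms N(1) n lam_pos D_pos K_nonneg
        by (intro mult_left_mono) auto
      also note N(2)
      finally show "dist (B t (real m) (J t (real m))) (B t ?n (J t ?n)) < e"
        by (simp add: dist_norm)
    qed
  qed
  then show ?thesis
    unfolding w_def by (simp add: Cauchy_convergent_iff convergent_LIMSEQ_iff)
qed

text \<open>The laws of \<open>B t n\<close> hold for \<open>n \<ge> t\<close>, so the limits over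
  \<open>n\<close> below are taken on tails.\<close>

lemma eventually_real_ge: "eventually (\<lambda>n. t \<le> real n) sequentially"
  using filterlim_real_sequentially by (simp add: filterlim_at_top)

lemma P_w:
  assumes "0 \<le> t"
  shows "P t (w t) = 0"
proof (rule LIMSEQ_unique)
  show "(\<lambda>n. P t (B t (real n) (J t (real n)))) \<longlonglongrightarrow> P t (w t)"
    by (intro blinfun.tendsto w_tendsto assms tendsto_const)
  show "(\<lambda>n. P t (B t (real n) (J t (real n)))) \<longlonglongrightarrow> 0"
    using eventually_real_ge[of t] by (intro tendsto_eventually) (auto simp: P_B assms elim: eventually_mono)
qed

lemma nrm_w:
  assumes "0 \<le> t"
  shows "nrm t (w t) \<le> D * K / lam"
proof (rule tendsto_upperbound)
  show "(\<lambda>n. nrm t (B t (real n) (J t (real n)))) \<longlonglongrightarrow> nrm t (w t)"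
    using bounded_seminorm.tendsto[OF bounded_seminorm_nrm[OF assms] w_tendsto[OF assms]] .
  show "eventually (\<lambda>n. nrm t (B t (real n) (J t (real n))) \<le> D * K / lam) sequentially"
    using eventually_real_ge[of t] by eventually_elim (rule nrm_B_J[OF assms])
qed simp

text \<open>The limit of the cocycle identity under \<open>B t n\<close>: the new piece
  \<open>J s t\<close> is carried forward to \<open>n\<close> and straight back, which leaves its
  component in \<open>Ker (P t)\<close>. Thus \<open>- w\<close> solves the kernel part of the
  equation.\<close>

lemma T_w:
  assumes "0 \<le> s" "s \<le> t"
  shows "T t s (w s) = w t + (J s t - P t (J s t))"
proof (rule LIMSEQ_unique)
  have t: "t \<ge> 0" using assms by simp
  show "(\<lambda>n. T t s (B s (real n) (J s (real n)))) \<longlonglongrightarrow> T t s (w s)"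
    by (intro blinfun.tendsto w_tendsto assms tendsto_const)
  have "eventually (\<lambda>n. B t (real n) (J t (real n)) + (J s t - P t (J s t)) = T t s (B s (real n) (J s (real n)))) sequentially"
    using eventually_real_ge[of t]
  proof eventually_elim
    case (elim n)
    interpret linear "B t (real n)" using t elim by (rule linear_B)
    have "T t s (B s (real n) (J s (real n))) = B t (real n) (T (real n) t (J s t) + J t (real n))"
      using assms elim by (simp add: T_B_B J_cocycle[of s t "real n"])
    also have "\<dots> = (J s t - P t (J s t)) + B t (real n) (J t (real n))"
      using t elim by (simp add: add B_T B_self)
    finally show ?case by simp
  qed
  moreover have "(\<lambda>n. B t (real n) (J t (real n)) + (J s t - P t (J s t))) \<longlonglongrightarrow> w t + (J s t - P t (J s t))"
    by (intro tendsto_add w_tendsto t tendsto_const)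
  ultimately show "(\<lambda>n. T t s (B s (real n) (J s (real n)))) \<longlonglongrightarrow> w t + (J s t - P t (J s t))"
    by (rule Lim_transform_eventually[rotated])
qed

text \<open>The first term contributes \<open>P t (J s t)\<close> to the forcing, and
  \<open>- w\<close> contributes the complementary part.\<close>

lemma solution_exists:
  "solution (\<lambda>t. P t (J 0 t) - w t)"
  unfolding solution_def
proof (intro allI impI, elim conjE)
  fix t s :: real assume st: "0 \<le> s" "s \<le> t"
  have "P t (J 0 t) = T t s (P s (J 0 s)) + P t (J s t)"
    using st by (simp add: J_cocycle[of 0 s t] blinfun.add_right T_P)
  then show "P t (J 0 t) - w t = T t s (P s (J 0 s) - w s) + J s t"
    using T_w[OF st] by (simp add: blinfun.diff_right)
qed

lemma nrm_solution:
  assumes t: "0 \<le> t"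
  shows "nrm t (P t (J 0 t) - w t) \<le> 2 * (D * K / lam)"
proof -
  interpret n: bounded_seminorm "nrm t" "C * exp (\<epsilon> * \<rho> t)"
    using t by (rule bounded_seminorm_nrm)
  show ?thesis
    using n.triangle[of "P t (J 0 t)" "- w t"] n.minus[of "w t"] nrm_P_J[OF order_refl t] nrm_w[OF t] by simp
qed

section \<open>Uniqueness and the function spaces\<close>

lemma solution_unique:
  assumes sol: "solution x" "solution x'"
    and Ker: "P 0 (x 0) = 0" "P 0 (x' 0) = 0"
    and bdd: "\<And>t. 0 \<le> t \<Longrightarrow> nrm t (x t) \<le> b" "\<And>t. 0 \<le> t \<Longrightarrow> nrm t (x' t) \<le> b"
    and t: "0 \<le> t"
  shows "x t = x' t"
proof -
  define z where "z = x 0 - x' 0"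
  have Tz: "T s 0 z = x s - x' s" if "0 \<le> s" for s
    using solutionD[OF sol(1) order_refl that] solutionD[OF sol(2) order_refl that]
    by (simp add: z_def blinfun.diff_right)
  have le: "norm z \<le> D * (2 * b) * exp (- lam * (\<rho> s - \<rho> 0))" if s: "0 \<le> s" for s
  proof -
    interpret n: bounded_seminorm "nrm s" "C * exp (\<epsilon> * \<rho> s)"
      using s by (rule bounded_seminorm_nrm)
    \<comment> \<open>Returning from \<open>s\<close> to 0 gives \<open>B 0 0 z = z - P 0 z\<close>,
      and \<open>P 0 z = 0\<close> because both solutions start in the kernel.\<close>
    have z: "B 0 s (T s 0 z) = z"
      using B_T[of 0 0 s z] s Ker by (simp add: B_self z_def blinfun.diff_right)
    have "nrm s (T s 0 z) \<le> 2 * b"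
      using n.triangle[of "x s" "- x' s"] n.minus[of "x' s"] bdd[OF s] by (simp add: Tz s)
    then have "D * exp (- lam * (\<rho> s - \<rho> 0)) * nrm s (T s 0 z) \<le> D * exp (- lam * (\<rho> s - \<rho> 0)) * (2 * b)"
      using D_pos by (intro mult_left_mono) auto
    then show ?thesis
      using nrm_B[of 0 s "T s 0 z"] nrm_ge[of 0 z] s by (simp add: z mult_ac)
  qed
  have "b \<ge> 0" using bdd(1)[of 0] nrm_nonneg[of 0 "x 0"] by simp
  then have Db: "0 \<le> D * (2 * b)" using D_pos by simp
  have "norm z \<le> 0"
  proof (rule ccontr)
    assume "\<not> norm z \<le> 0"
    then have "norm z > 0" by simp
    with Db obtain N where "N \<ge> 0" "D * (2 * b) * exp (- lam * (\<rho> N - \<rho> 0)) < norm z"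
      by (rule exp_decay)
    with le[of N] show False by simp
  qed
  then show ?thesis using Tz[OF t] by (simp add: blinfun.zero_right)
qed

text \<open>Uniqueness of the integral identifies the existential witness with
  \<open>J s t\<close>.\<close>

lemma solution_iff:
  "solution x \<longleftrightarrow> (\<forall>t s. 0 \<le> s \<and> s \<le> t \<longrightarrow>
      (\<exists>I. has_banach_integral (lebesgue_on {s..t}) (\<lambda>\<tau>. \<rho>' \<tau> *\<^sub>R T t \<tau> (y \<tau>)) I \<and>
           x t = T t s (x s) + I))"
proof -
  have "x t = T t s (x s) + J s t \<longleftrightarrow>
      (\<exists>I. has_banach_integral (lebesgue_on {s..t}) (\<lambda>\<tau>. \<rho>' \<tau> *\<^sub>R T t \<tau> (y \<tau>)) I \<and>
           x t = T t s (x s) + I)" if "0 \<le> s" "s \<le> t" for s t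
  proof -
    have J: "has_banach_integral (lebesgue_on {s..t}) (\<lambda>\<tau>. \<rho>' \<tau> *\<^sub>R T t \<tau> (y \<tau>)) (J s t)"
      using has_integral_J[OF that] by (simp add: integrand_def[abs_def])
    show ?thesis
    proof
      assume "x t = T t s (x s) + J s t"
      with J show "\<exists>I. has_banach_integral (lebesgue_on {s..t}) (\<lambda>\<tau>. \<rho>' \<tau> *\<^sub>R T t \<tau> (y \<tau>)) I \<and>
           x t = T t s (x s) + I"
        by blast
    next
      assume "\<exists>I. has_banach_integral (lebesgue_on {s..t}) (\<lambda>\<tau>. \<rho>' \<tau> *\<^sub>R T t \<tau> (y \<tau>)) I \<and>
           x t = T t s (x s) + I"
      then show "x t = T t s (x s) + J s t"
        using has_banach_integral_unique[OF J] by metis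
    qed
  qed
  then show ?thesis by (simp add: solution_def cong: imp_cong)
qed

lemma Y_inf_bounded:
  assumes "x \<in> Y_inf nrm"
  obtains b where "\<And>t. 0 \<le> t \<Longrightarrow> nrm t (x t) \<le> b"
proof -
  have fin: "Y_norm nrm x < top" using assms by (simp add: Y_inf_def)
  have "nrm t (x t) \<le> enn2real (Y_norm nrm x)" if "0 \<le> t" for t
  proof -
    have "ennreal (nrm t (x t)) \<le> Y_norm nrm x"
      unfolding Y_norm_def using that by (intro SUP_upper) simp
    then show ?thesis
      using fin enn2real_mono[of "ennreal (nrm t (x t))"] that by (simp add: nrm_nonneg)
  qed
  then show ?thesis by (rule that)
qed

lemma ex1_solution:
  "\<exists>!x. x \<in> Y_inf_sub nrm (Ker (P 0)) \<and> solution x"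
proof (rule ex_ex1I)
  \<comment> \<open>Restriction makes \<open>x\<close> extensional, as \<open>Y_inf\<close> demands;
    the equation sees only times in \<open>[0, \<infinity>)\<close>.\<close>
  define x where "x = restrict (\<lambda>t. P t (J 0 t) - w t) {0..}"
  have x_eq: "x t = P t (J 0 t) - w t" if "0 \<le> t" for t
    using that by (simp add: x_def)
  have sol: "solution x"
    using solution_exists by (simp add: solution_def x_eq)
  have "Y_norm nrm x \<le> ennreal (2 * (D * K / lam))"
    unfolding Y_norm_def by (intro SUP_least ennreal_leI) (use nrm_solution in \<open>simp add: x_eq\<close>)
  also have "\<dots> < \<infinity>" by simp
  finally have "x \<in> Y_inf nrm"
    using solution_continuous[OF sol] by (simp add: Y_inf_def x_def)
  \<comment> \<open>Since \<open>J 0 0 = 0\<close>, the initial value is \<open>- w 0\<close>, which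
    lies in the kernel.\<close>
  moreover have "x 0 \<in> Ker (P 0)"
    by (simp add: x_eq J_self Ker_def P_w blinfun.zero_right blinfun.minus_right)
  ultimately show "\<exists>x. x \<in> Y_inf_sub nrm (Ker (P 0)) \<and> solution x"
    using sol by (auto simp: Y_inf_sub_def)
next
  fix x x' assume x: "x \<in> Y_inf_sub nrm (Ker (P 0)) \<and> solution x"
    and x': "x' \<in> Y_inf_sub nrm (Ker (P 0)) \<and> solution x'"
  obtain b where b: "\<And>t. 0 \<le> t \<Longrightarrow> nrm t (x t) \<le> b"
    by (rule Y_inf_bounded[of x]) (use x in \<open>simp add: Y_inf_sub_def\<close>, rule that)
  obtain b' where b': "\<And>t. 0 \<le> t \<Longrightarrow> nrm t (x' t) \<le> b'"
    by (rule Y_inf_bounded[of x']) (use x' in \<open>simp add: Y_inf_sub_def\<close>, rule that)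
  have "x t = x' t" if "0 \<le> t" for t
  proof (rule solution_unique[where b="max b b'"])
    show "nrm t (x t) \<le> max b b'" "nrm t (x' t) \<le> max b b'" if "0 \<le> t" for t
      using b[OF that] b'[OF that] by auto
  qed (use x x' that in \<open>auto simp: Y_inf_sub_def Ker_def\<close>)
  then show "x = x'"
    using x x' by (intro extensionalityI[of x "{0..}" x']) (auto simp: Y_inf_sub_def Y_inf_def)
qed

end

theorem proposition3:
  fixes T :: "real \<Rightarrow> real \<Rightarrow> 'a::banach \<Rightarrow>\<^sub>L 'a"
    and \<rho> \<rho>' :: "real \<Rightarrow> real"
    and nrm :: "real \<Rightarrow> 'a \<Rightarrow> real"
    and P :: "real \<Rightarrow> 'a \<Rightarrow>\<^sub>L 'a"
    and C \<epsilon> :: real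
    and y :: "real \<Rightarrow> 'a"
  assumes "evolution_family T"
    and "\<rho> \<in> {0..} \<rightarrow> {0..}"
    and "strict_mono_on {0..} \<rho>"
    and "\<And>t. t \<ge> 0 \<Longrightarrow> (\<rho> has_real_derivative \<rho>' t) (at t within {0..})"
    and "continuous_on {0..} \<rho>'"
    and "\<rho> 0 = 0"
    and "filterlim \<rho> at_top at_top"
    and "\<And>t. t \<ge> 0 \<Longrightarrow> is_norm (nrm t)"
    and "\<And>x. continuous_on {0..} (\<lambda>t. nrm t x)"
    and "C > 0" and "\<epsilon> \<ge> 0"
    and "\<And>t x. t \<ge> 0 \<Longrightarrow> norm x \<le> nrm t x \<and> nrm t x \<le> C * exp (\<epsilon> * \<rho> t) * norm x"
    and "rho_dichotomy \<rho> nrm T P"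
    and "y \<in> Y'_inf nrm"
  shows "\<exists>!x. x \<in> Y_inf_sub nrm (Ker (P 0)) \<and>
           (\<forall>t s. 0 \<le> s \<and> s \<le> t \<longrightarrow>
              (\<exists>I. has_banach_integral (lebesgue_on {s..t}) (\<lambda>\<tau>. \<rho>' \<tau> *\<^sub>R T t \<tau> (y \<tau>)) I \<and>
                   x t = T t s (x s) + I))"
proof -
  obtain lam D where lam: "lam > 0" and D: "D > 0"
    and est: "\<forall>x. (\<forall>t s. 0 \<le> s \<and> s \<le> t \<longrightarrow>
           nrm t (T t s (P s x)) \<le> D * exp (- lam * (\<rho> t - \<rho> s)) * nrm s x) \<and>
        (\<forall>t s. 0 \<le> t \<and> t \<le> s \<longrightarrow>
           nrm t (backward T P t s (x - P s x)) \<le> D * exp (- lam * (\<rho> s - \<rho> t)) * nrm s x)"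
    using assms(13) unfolding rho_dichotomy_def by (elim conjE exE) (rule that)
  have fin: "Y'_norm nrm y < top" and meas: "bochner_measurable (lebesgue_on {0..}) y"
    using assms(14) by (auto simp: Y'_inf_def)
  \<comment> \<open>The essential supremum is finite, so \<open>enn2real\<close> keeps its value and
    provides the real bound \<open>K\<close>.\<close>
  have "AE \<tau> in lebesgue_on {0..}. nrm \<tau> (y \<tau>) \<le> enn2real (Y'_norm nrm y)"
    using esssup_AE[of "\<lambda>t. ennreal (nrm t (y t))" "lebesgue_on {0..}"] AE_space
  proof eventually_elim
    case (elim \<tau>)
    then have "ennreal (nrm \<tau> (y \<tau>)) \<le> ennreal (enn2real (Y'_norm nrm y))"
      using fin by (simp add: Y'_norm_def)
    then show ?case by (simp add: ennreal_le_iff)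
  qed
  then interpret dichotomous_equation T \<rho> \<rho>' nrm P C \<epsilon> lam D y "enn2real (Y'_norm nrm y)"
    using assms(13) strict_mono_on_leD[OF assms(3)] est
    by unfold_locales (simp_all add: rho_dichotomy_def assms(1,4,5,7,8,10-12) lam D meas)
  show ?thesis
    using ex1_solution unfolding solution_iff .
qed

end
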